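(* Let $\mathcal M$ be a countable class of environments and let $\varepsilon>0$. Let $\tau,M,H,N$ be AIQI parameters with $$\tau\le\frac{\varepsilon(1-\gamma)}{10},\qquad M\ge\frac{10}{\varepsilon(1-\gamma)},\qquad H=H(\eta)\ \text{ for some } 0<\eta\le\frac{\varepsilon(1-\gamma)}{10},\qquad N\ge H+\log_\gamma\frac{\varepsilon}{5},$$ and let $\psi$ be a unified return-predictor that has a grain of truth with respect to every environment $\nu\in\mathcal M$ (for the parameters $H,M,N,\tau$). Then for any mixture environment $\xi$ of $\mathcal M$, the AIQI policy $\pi=\hat\pi^{H,M,N,\tau}_\psi$ is asymptotically $\varepsilon$-optimal in $\xi$: the inequality $$\limsup_{t\to\infty}\bigl(V^\ast_\xi(h_{<t})-V^\pi_\xi(h_{<t})\bigr)\le\varepsilon$$ holds $\xi^\pi$-almost surely and, for every $\nu\in\mathcal M$, $\nu^\pi$-almost surely.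
   Context: **General RL.** $\mathcal A$, $\mathcal O$ are finite nonempty sets (actions, observations), $\mathcal R\subseteq[0,1]$ is a finite set of rewards, $\mathcal E=\mathcal O\times\mathcal R$ is the set of percepts; $r_t$ is the reward component of $e_t$. A history is $h_{1:t}=a_1e_1\dots a_te_t$, $h_{<t}=h_{1:t-1}$, $\mathcal H=(\mathcal A\times\mathcal E)^*$, and $\Omega=(\mathcal A\times\mathcal E)^\infty$ is the set of outcomes $h$. A policy is a map $\pi:\mathcal H\to\Delta\mathcal A$, an environment is a map $\nu:\mathcal H\times\mathcal A\to\Delta\mathcal E$ ($\Delta X$ = probability distributions on $X$). $\nu^\pi$ is the probability measure on $\Omega$ with $\nu^\pi(h_{1:t})=\prod_{i\le t}\pi(a_i\mid h_{<i})\,\nu(e_i\mid h_{<i}a_i)$. Conditional probabilities/expectations given $h_{<t}$ or $h_{<t}a_t$ are those obtained by continuing the interaction from there with $\pi$ and $\nu$. Fix a discount $\gamma\in(0,1)$. The return is $R_t=(1-\gamma)\sum_{k\ge0}\gamma^kr_{t+k}$, the $H$-step return is $R_{t,H}=(1-\gamma)\sum_{k=0}^{H-1}\gamma^kr_{t+k}$; $V^\pi_\nu(h_{<t})=\mathbb E^\pi_\nu[R_t\mid h_{<t}]$, $Q^\pi_\nu(h_{<t},a_t)=\mathbb E^\pi_\nu[R_t\mid h_{<t}a_t]$, $V^\ast_\nu=\sup_\pi V^\pi_\nu$. For $\eta>0$ the $\eta$-effective horizon is $H(\eta)=\min\{H\in\mathbb Z_+: (1-\gamma)\sum_{k\ge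 H}\gamma^k\le\eta\}$. **Mixture environment.** For a countable class $\mathcal M$ and a prior distribution $w$ on $\mathcal M$ with $w(\nu)>0$ for all $\nu\in\mathcal M$, the mixture environment $\xi$ is the environment with $\xi(e_{1:t}\parallel a_{1:t})=\sum_{\nu\in\mathcal M}w(\nu)\,\nu(e_{1:t}\parallel a_{1:t})$, where $\nu(e_{1:t}\parallel a_{1:t})=\prod_{i\le t}\nu(e_i\mid h_{<i}a_i)$; equivalently $\xi^\pi=\sum_\nu w(\nu)\nu^\pi$ for every policy $\pi$. **Augmented histories.** AIQI parameters: $H\in\mathbb Z_+$ (return horizon), $M\in\mathbb Z_+$ (discretization level), $N\in\mathbb Z_+$ with $N\ge H$ (augmentation period), $\tau\in(0,1]$ (exploration rate). The discretized return is $z_t=\lfloor M R_{t,H}\rfloor/M\in\mathcal Z:=\{0,\frac1M,\dots,\frac{M-1}M\}$. For a phase $n\in\{0,\dots,N-1\}$, the augmented sample space is $\tilde\Omega^{(n)}=\prod_{i\ge1}\mathcal B^{(n)}_i$ with $\mathcal B^{(n)}_i=\mathcal A\times\mathcal Z\times\mathcal E$ if $i\equiv n\pmod N$ and $\mathcal A\times\mathcal E$ otherwise; so an augmented outcome $\tilde h^{(n)}$ has an extra symbol $\tilde z_i\in\mathcal Z$ (not required to equal the true $z_i$) between $a_i$ and $e_i$ for each $i\equiv n$. $\tilde h^{(n)}_{<t}$ denotes its prefix consisting of blocks $1,\dots,t-1$, and $h_{<t}$ is obtained from it by deleting the symbols $\tilde z_i$. The map $\mathrm{aug}_n:\Omega\to\tilde\Omega^{(n)}$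 inserts the true values $z_i$ (computed from the rewards $r_i,\dots,r_{i+H-1}$ of $h$) at all positions $i\equiv n\pmod N$. If $(t-1-n)\bmod N\ge H-1$ (in particular if $n=t\bmod N$), $\mathrm{aug}_n(h)_{<t}$ depends only on $h_{<t}$, and is written $\mathrm{aug}_n(h_{<t})$. **Return-predictors.** A phase-$n$ return-predictor is a map $\phi$ assigning to each pair ($\tilde h^{(n)}_{<i},a_i$) with $i\equiv n\pmod N$ a distribution $\phi(\cdot\mid\tilde h^{(n)}_{<i}a_i)\in\Delta\mathcal Z$. Given a countable class $\mathcal P_n$ of phase-$n$ return-predictors and prior weights $\omega_n(\phi)>0$ summing to 1, the mixture $\psi_n$ is the phase-$n$ return-predictor with $\prod_{k=0}^K\psi_n(\tilde z_{i_k}\mid\tilde h^{(n)}_{<i_k}a_{i_k})=\sum_{\phi\in\mathcal P_n}\omega_n(\phi)\prod_{k=0}^K\phi(\tilde z_{i_k}\mid\tilde h^{(n)}_{<i_k}a_{i_k})$ for all $K\ge0$ and all augmented histories, where $i_0<i_1<\dots$ enumerate the positive integers $\equiv n\pmod N$. A unified return-predictor $\psi$ is given by mixtures $\psi_0,\dots,\psi_{N-1}$ via $\psi(\tilde z_t\mid h_{<t}a_t)=\psi_n(\tilde z_t\mid\mathrm{aug}_n(h_{<t})a_t)$ with $n=t\bmod N$. **AIQI.** Let $\hat Q(h_{<t},a_t)=\sum_{\tilde z\in\mathcal Z}\tilde z\,\psi(\tilde z\mid h_{<t}a_t)$. The AIQI policy $\hat\pi^{H,M,N,\tau}_\psi$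 is $\hat\pi(a\mid h_{<t})=(1-\tau)\mathbf 1[a=a^\ast]+\tau/|\mathcal A|$ with $a^\ast=\arg\max_{a}\hat Q(h_{<t},a)$, where stochastic tie-breaking is allowed (the indicator may be replaced by any probability distribution supported on the maximizers of $\hat Q(h_{<t},\cdot)$). **Grain of truth.** With $\hat\pi=\hat\pi^{H,M,N,\tau}_\psi$, $\psi$ has a grain of truth w.r.t. $\nu$ if for every $n$ the class $\mathcal P_n$ of the mixture $\psi_n$ contains the return-predictor $\phi^\ast(\tilde z_i\mid\tilde h^{(n)}_{<i}a_i)=\nu^{\hat\pi}(z_i=\tilde z_i\mid h_{<i}a_i)$, $i\equiv n\pmod N$. *)

theory Defs
  imports "HOL-Probability.Probability"
begin

text \<open>
  The finite nonempty sets of actions and observations are finite types. The finite reward set is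
  the range of an injection \<open>rew\<close> from a finite type \<open>'r\<close> into the unit interval.
  A history is a list of blocks (action, (observation, reward)). Lists and outcomes are indexed
  from 0, so the block of time \<open>t\<close> has index \<open>t - 1\<close>, and the history before time \<open>t\<close> has
  length \<open>t - 1\<close>; the time following a history \<open>h\<close> is \<open>Suc (length h)\<close>.
\<close>

type_synonym ('a, 'o, 'r) block = "'a \<times> 'o \<times> 'r"
type_synonym ('a, 'o, 'r) history = "('a, 'o, 'r) block list"
type_synonym ('a, 'o, 'r) outcome = "nat \<Rightarrow> ('a, 'o, 'r) block"
type_synonym ('a, 'o, 'r) policy = "('a, 'o, 'r) history \<Rightarrow> 'a pmf"
type_synonym ('a, 'o, 'r) env = "('a, 'o, 'r) history \<Rightarrow> 'a \<Rightarrow> ('o \<times> 'r) pmf"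

definition reward_structure :: "('r::finite \<Rightarrow> real) \<Rightarrow> bool" where
  "reward_structure rew \<longleftrightarrow> inj rew \<and> range rew \<subseteq> {0..1}"

definition hist_before :: "('a, 'o, 'r) outcome \<Rightarrow> nat \<Rightarrow> ('a, 'o, 'r) history" where
  "hist_before \<omega> t = map \<omega> [0..<t - 1]"

definition step_pmf ::
  "('a, 'o, 'r) policy \<Rightarrow> ('a, 'o, 'r) env \<Rightarrow> ('a, 'o, 'r) history \<Rightarrow> ('a, 'o, 'r) block pmf" where
  "step_pmf \<pi> \<nu> h = bind_pmf (\<pi> h) (\<lambda>a. map_pmf (Pair a) (\<nu> h a))"

text \<open>
  The measure determined by the probabilities of finite histories in \<open>interaction_cylinder\<close>
  below, obtained as the Ionescu-Tulcea limit of the one-step kernels.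
\<close>

definition interaction ::
  "('a::finite, 'o::finite, 'r::finite) policy \<Rightarrow> ('a, 'o, 'r) env \<Rightarrow> ('a, 'o, 'r) outcome measure" where
  "interaction \<pi> \<nu> =
     projective_family.lim UNIV
       (Ionescu_Tulcea.CI (\<lambda>n x. measure_pmf (step_pmf \<pi> \<nu> (map x [0..<n]))) (\<lambda>_. count_space UNIV))
       (\<lambda>_. count_space UNIV)"

lemma pmf_step_pmf: "pmf (step_pmf \<pi> \<nu> h) (a, e) = pmf (\<pi> h) a * pmf (\<nu> h a) e"
proof -
  have "pmf (map_pmf (Pair b) (\<nu> h b)) (a, e) = indicator {a} b * pmf (\<nu> h a) e" for b
  proof (cases "b = a")
    case True
    then show ?thesis by (simp add: pmf_map_inj' inj_on_def)
  next
    case False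
    then have "(a, e) \<notin> set_pmf (map_pmf (Pair b) (\<nu> h b))" by auto
    then have "pmf (map_pmf (Pair b) (\<nu> h b)) (a, e) = 0" by (meson set_pmf_iff)
    then show ?thesis using False by simp
  qed
  then show ?thesis
    by (simp add: step_pmf_def pmf_bind measure_pmf_single)
qed

lemma sets_PiM_finite_count_space:
  fixes n :: nat
  shows "sets (PiM {0..<n} (\<lambda>_. count_space (UNIV :: 'b::finite set))) = Pow ({0..<n} \<rightarrow>\<^sub>E UNIV)"
  by (subst count_space_PiM_finite) (auto intro: countable_finite)

lemma Ionescu_Tulcea_step:
  fixes \<pi> :: "('a::finite, 'o::finite, 'r::finite) policy"
  shows "Ionescu_Tulcea (\<lambda>n x. measure_pmf (step_pmf \<pi> \<nu> (map x [0..<n]))) (\<lambda>_. count_space UNIV)"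
proof
  fix i
  show "(\<lambda>x. measure_pmf (step_pmf \<pi> \<nu> (map x [0..<i]))) \<in>
      measurable (PiM {0..<i} (\<lambda>_. count_space UNIV)) (subprob_algebra (count_space UNIV))"
    by (subst count_space_PiM_finite)
      (auto intro: countable_finite measure_pmf_in_subprob_algebra)
qed

lemma space_interaction [simp]: "space (interaction \<pi> \<nu>) = UNIV"
  and sets_interaction: "sets (interaction \<pi> \<nu>) = sets (PiM UNIV (\<lambda>_. count_space UNIV))"
  and prob_space_interaction: "prob_space (interaction \<pi> \<nu>)"
proof -
  interpret IT: Ionescu_Tulcea "\<lambda>n x. measure_pmf (step_pmf \<pi> \<nu> (map x [0..<n]))" "\<lambda>_. count_space UNIV"
    by (rule Ionescu_Tulcea_step)
  show sp: "space (interaction \<pi> \<nu>) = UNIV"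
    by (simp add: interaction_def space_PiM)
  show "sets (interaction \<pi> \<nu>) = sets (PiM UNIV (\<lambda>_. count_space UNIV))"
    by (simp add: interaction_def)
  have "emeasure IT.PF.lim (IT.PF.emb UNIV {} {\<lambda>x. undefined}) = 1"
    using IT.lim[of "{}" "{\<lambda>x. undefined}"] IT.PF.prob_space_P[of "{}"]
    by (simp add: prob_space.emeasure_space_1[symmetric] IT.PF.space_P PiM_empty)
  moreover have "IT.PF.emb UNIV {} {\<lambda>x. undefined} = UNIV"
    by (auto simp: prod_emb_def restrict_def)
  ultimately show "prob_space (interaction \<pi> \<nu>)"
    by (intro prob_spaceI) (simp add: sp, simp add: interaction_def)
qed

lemma interaction_cylinder:
  fixes \<pi> :: "('a::finite, 'o::finite, 'r::finite) policy"
  shows "measure (interaction \<pi> \<nu>) {\<omega>. map \<omega> [0..<length h] = h} =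
    (\<Prod>i<length h. pmf (\<pi> (take i h)) (fst (h ! i)) * pmf (\<nu> (take i h) (fst (h ! i))) (snd (h ! i)))"
proof -
  let ?M = "\<lambda>_::nat. count_space (UNIV :: ('a, 'o, 'r) block set)"
  interpret IT: Ionescu_Tulcea "\<lambda>n x. measure_pmf (step_pmf \<pi> \<nu> (map x [0..<n]))" ?M
    by (rule Ionescu_Tulcea_step)
  let ?x = "\<lambda>n. restrict (\<lambda>i. h ! i) {0..<n}"
  let ?p = "\<lambda>i. pmf (step_pmf \<pi> \<nu> (take i h)) (h ! i)"
  have C: "n \<le> length h \<Longrightarrow> emeasure (IT.C 0 n (\<lambda>_. undefined)) {?x n} = ennreal (\<Prod>i<n. ?p i)" for n
  proof (induction n)
    case 0
    have "?x 0 = (\<lambda>_. undefined)" by (auto simp: restrict_def)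
    then show ?case by (simp add: PiM_empty)
  next
    case (Suc n)
    let ?C = "IT.C 0 n (\<lambda>_. undefined)"
    have sC: "space ?C = {0..<n} \<rightarrow>\<^sub>E UNIV" by (subst IT.space_C) (auto simp: space_PiM)
    have sets_x: "{?x m} \<in> sets (PiM {0..<m} ?M)" for m
      by (simp add: sets_PiM_finite_count_space)
    have setsC: "{?x n} \<in> sets ?C"
      by (subst IT.sets_C) (simp_all add: space_PiM sets_PiM_finite_count_space)
    have ne: "space ?C \<noteq> {}" by (auto simp: sC PiE_eq_empty_iff)
    have eP: "emeasure (IT.eP n x) {?x (Suc n)} = ennreal (?p n) * indicator {?x n} x"
      if x: "x \<in> {0..<n} \<rightarrow>\<^sub>E UNIV" for x
    proof -
      have "emeasure (IT.eP n x) {?x (Suc n)} =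
          emeasure (measure_pmf (step_pmf \<pi> \<nu> (map x [0..<n]))) {y. x(n := y) = ?x (Suc n)}"
        using x sets_x[of "Suc n"] by (subst IT.emeasure_eP) (auto simp: space_PiM intro!: arg_cong2[where f=emeasure])
      also have "\<dots> = ennreal (?p n) * indicator {?x n} x"
      proof (cases "x = ?x n")
        case True
        have "{y. x(n := y) = ?x (Suc n)} = {h ! n}"
          using True by (auto simp: fun_eq_iff restrict_def less_Suc_eq)
        moreover have "map x [0..<n] = take n h"
          using True Suc.prems by (auto intro!: nth_equalityI)
        ultimately show ?thesis using True by (simp add: emeasure_pmf_single)
      next
        case False
        have "{y. x(n := y) = ?x (Suc n)} = {}"
        proof (rule ccontr)
          assume "{y. x(n := y) = ?x (Suc n)} \<noteq> {}"
          then obtain y where y: "x(n := y) = ?x (Suc n)" by auto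
          have "x i = ?x n i" for i
            using fun_cong[OF y, of i] x
            by (cases "i < n") (auto simp: PiE_def extensional_def split: if_splits)
          then show False using False by auto
        qed
        then show ?thesis using False by (simp only:) simp
      qed
      finally show ?thesis .
    qed
    have IH: "emeasure ?C {?x n} = ennreal (\<Prod>i<n. ?p i)"
      by (rule Suc.IH[OF Suc_leD[OF Suc.prems]])
    have "emeasure (IT.C 0 (Suc n) (\<lambda>_. undefined)) {?x (Suc n)} =
        (\<integral>\<^sup>+x. emeasure (IT.eP n x) {?x (Suc n)} \<partial>?C)"
      using ne sets_x[of "Suc n"]
      by (simp, subst emeasure_bind[where N="PiM {0..<Suc n} ?M"])
        (auto intro!: IT.measurable_eP simp: measurable_cong_sets[OF IT.sets_C] space_PiM)
    also have "\<dots> = (\<integral>\<^sup>+x. ennreal (?p n) * indicator {?x n} x \<partial>?C)"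
      by (intro nn_integral_cong eP) (simp add: sC)
    also have "\<dots> = ennreal (?p n) * emeasure ?C {?x n}"
      using setsC by (simp add: nn_integral_cmult_indicator)
    also have "\<dots> = ennreal (\<Prod>i<Suc n. ?p i)"
      unfolding IH prod.lessThan_Suc mult.commute[of _ "?p n"]
      by (rule ennreal_mult[symmetric]) (intro prod_nonneg pmf_nonneg ballI)+
    finally show ?case .
  qed
  let ?n = "length h"
  have emb: "IT.PF.emb UNIV {0..<?n} {?x ?n} = {\<omega>. map \<omega> [0..<?n] = h}"
  proof -
    have "restrict \<omega> {0..<?n} = ?x ?n \<longleftrightarrow> (\<forall>i\<in>{0..<?n}. \<omega> i = h ! i)" for \<omega>
    proof
      assume *: "restrict \<omega> {0..<?n} = ?x ?n"
      show "\<forall>i\<in>{0..<?n}. \<omega> i = h ! i"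
      proof
        fix i assume "i \<in> {0..<?n}"
        then show "\<omega> i = h ! i" using fun_cong[OF *, of i] by simp
      qed
    qed (rule restrict_ext, blast)
    moreover have "map \<omega> [0..<?n] = h \<longleftrightarrow> (\<forall>i\<in>{0..<?n}. \<omega> i = h ! i)" for \<omega>
    proof
      assume *: "map \<omega> [0..<?n] = h"
      show "\<forall>i\<in>{0..<?n}. \<omega> i = h ! i"
      proof
        fix i assume "i \<in> {0..<?n}"
        then show "\<omega> i = h ! i" using arg_cong[OF *, of "\<lambda>l. l ! i"] by simp
      qed
    qed (rule nth_equalityI, auto)
    ultimately show ?thesis
      unfolding prod_emb_def by (simp add: space_PiM vimage_def)
  qed
  have "emeasure (interaction \<pi> \<nu>) {\<omega>. map \<omega> [0..<?n] = h} = emeasure (IT.CI {0..<?n}) {?x ?n}"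
    unfolding interaction_def emb[symmetric]
    by (rule IT.lim) (simp_all add: sets_PiM_finite_count_space)
  also have "\<dots> = emeasure (IT.C 0 ?n (\<lambda>_. undefined)) (IT.PF.emb {0..<?n} {0..<?n} {?x ?n})"
    by (rule IT.emeasure_CI) (simp_all add: sets_PiM_finite_count_space)
  also have "IT.PF.emb {0..<?n} {0..<?n} {?x ?n} = {?x ?n}"
    by (rule prod_emb_id) auto
  finally have "emeasure (interaction \<pi> \<nu>) {\<omega>. map \<omega> [0..<?n] = h} = ennreal (\<Prod>i<?n. ?p i)"
    using C[of ?n] by simp
  then have "measure (interaction \<pi> \<nu>) {\<omega>. map \<omega> [0..<?n] = h} = (\<Prod>i<?n. ?p i)"
    by (simp add: measure_def prod_nonneg)
  also have "\<dots> = (\<Prod>i<?n. pmf (\<pi> (take i h)) (fst (h ! i)) * pmf (\<nu> (take i h) (fst (h ! i))) (snd (h ! i)))"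
    by (intro prod.cong refl) (simp add: pmf_step_pmf[symmetric])
  finally show ?thesis .
qed

text \<open>
  Conditioning on a history, or on a history and the next action, by continuing the interaction:
  index 0 of the resulting outcome is the block right after \<open>h\<close>. No positivity of the
  probability of \<open>h\<close> or of \<open>a\<close> is needed.
\<close>

definition continue_from ::
  "('a::finite, 'o::finite, 'r::finite) policy \<Rightarrow> ('a, 'o, 'r) env \<Rightarrow> ('a, 'o, 'r) history \<Rightarrow>
   ('a, 'o, 'r) outcome measure" where
  "continue_from \<pi> \<nu> h = interaction (\<lambda>g. \<pi> (h @ g)) (\<lambda>g. \<nu> (h @ g))"

definition continue_from_act ::
  "('a::finite, 'o::finite, 'r::finite) policy \<Rightarrow> ('a, 'o, 'r) env \<Rightarrow> ('a, 'o, 'r) history \<Rightarrow> 'a \<Rightarrow>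
   ('a, 'o, 'r) outcome measure" where
  "continue_from_act \<pi> \<nu> h a =
     interaction (\<lambda>g. if g = [] then return_pmf a else \<pi> (h @ g)) (\<lambda>g. \<nu> (h @ g))"

definition reward_at :: "('r \<Rightarrow> real) \<Rightarrow> ('a, 'o, 'r) outcome \<Rightarrow> nat \<Rightarrow> real" where
  "reward_at rew \<omega> i = rew (snd (snd (\<omega> i)))"

definition ret :: "real \<Rightarrow> ('r \<Rightarrow> real) \<Rightarrow> ('a, 'o, 'r) outcome \<Rightarrow> nat \<Rightarrow> real" where
  "ret \<gamma> rew \<omega> i = (1 - \<gamma>) * (\<Sum>k. \<gamma> ^ k * reward_at rew \<omega> (i + k))"

definition ret_upto :: "real \<Rightarrow> ('r \<Rightarrow> real) \<Rightarrow> nat \<Rightarrow> ('a, 'o, 'r) outcome \<Rightarrow> nat \<Rightarrow> real" where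
  "ret_upto \<gamma> rew H \<omega> i = (1 - \<gamma>) * (\<Sum>k<H. \<gamma> ^ k * reward_at rew \<omega> (i + k))"

definition policy_value ::
  "real \<Rightarrow> ('r \<Rightarrow> real) \<Rightarrow> ('a::finite, 'o::finite, 'r::finite) policy \<Rightarrow> ('a, 'o, 'r) env \<Rightarrow>
   ('a, 'o, 'r) history \<Rightarrow> real" where
  "policy_value \<gamma> rew \<pi> \<nu> h = (\<integral>\<omega>. ret \<gamma> rew \<omega> 0 \<partial>continue_from \<pi> \<nu> h)"

definition opt_value ::
  "real \<Rightarrow> ('r \<Rightarrow> real) \<Rightarrow> ('a::finite, 'o::finite, 'r::finite) env \<Rightarrow> ('a, 'o, 'r) history \<Rightarrow> real" where
  "opt_value \<gamma> rew \<nu> h = (SUP \<pi>. policy_value \<gamma> rew \<pi> \<nu> h)"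

definition effective_horizon :: "real \<Rightarrow> real \<Rightarrow> nat" where
  "effective_horizon \<gamma> \<eta> = (LEAST H. 0 < H \<and> (1 - \<gamma>) * (\<Sum>k. \<gamma> ^ (H + k)) \<le> \<eta>)"

definition env_prob :: "('a, 'o, 'r) env \<Rightarrow> ('a, 'o, 'r) history \<Rightarrow> real" where
  "env_prob \<nu> h = (\<Prod>i<length h. pmf (\<nu> (take i h) (fst (h ! i))) (snd (h ! i)))"

text \<open>
  The defining equation leaves \<open>\<xi>\<close> unconstrained after histories of \<open>\<xi>\<close>-probability 0, hence a
  predicate. A prior that is positive on \<open>\<M>\<close> is a pmf with support \<open>\<M>\<close>.
\<close>

definition mixture_env ::
  "('a, 'o, 'r) env set \<Rightarrow> ('a, 'o, 'r) env pmf \<Rightarrow> ('a, 'o, 'r) env \<Rightarrow> bool" where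
  "mixture_env \<M> w \<xi> \<longleftrightarrow> set_pmf w = \<M> \<and>
     (\<forall>h. ((\<lambda>\<nu>. pmf w \<nu> * env_prob \<nu> h) has_sum env_prob \<xi> h) \<M>)"

definition zvals :: "nat \<Rightarrow> real set" where
  "zvals M = (\<lambda>j. real j / real M) ` {..<M}"

definition disc_return ::
  "real \<Rightarrow> ('r \<Rightarrow> real) \<Rightarrow> nat \<Rightarrow> nat \<Rightarrow> ('a, 'o, 'r) outcome \<Rightarrow> nat \<Rightarrow> real" where
  "disc_return \<gamma> rew H M \<omega> i = real_of_int \<lfloor>real M * ret_upto \<gamma> rew H \<omega> i\<rfloor> / real M"

type_synonym ('a, 'o, 'r) aug_history = "('a \<times> real option \<times> 'o \<times> 'r) list"

text \<open>\<open>Suc i\<close> is the time of the block with index \<open>i\<close>.\<close>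

definition aug_hists :: "nat \<Rightarrow> nat \<Rightarrow> nat \<Rightarrow> ('a, 'o, 'r) aug_history set" where
  "aug_hists M N n = {g. \<forall>i<length g.
     if Suc i mod N = n then fst (snd (g ! i)) \<in> Some ` zvals M else fst (snd (g ! i)) = None}"

definition strip :: "('a, 'o, 'r) aug_history \<Rightarrow> ('a, 'o, 'r) history" where
  "strip g = map (\<lambda>(a, z, e). (a, e)) g"

text \<open>
  \<open>aug_outcome \<dots> \<omega> m\<close> consists of the first \<open>m\<close> blocks of the augmentation of \<open>\<omega>\<close>. In \<open>aug\<close>, a
  history is read as the outcome \<open>(!) h\<close>, whose unspecified entries beyond \<open>h\<close> are not used for
  the phase of the next time step, by \<open>aug_prefix\<close>.
\<close>

definition aug_outcome ::
  "real \<Rightarrow> ('r \<Rightarrow> real) \<Rightarrow> nat \<Rightarrow> nat \<Rightarrow> nat \<Rightarrow> nat \<Rightarrow> ('a, 'o, 'r) outcome \<Rightarrow> nat \<Rightarrow>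
   ('a, 'o, 'r) aug_history" where
  "aug_outcome \<gamma> rew H M N n \<omega> m =
     map (\<lambda>i. (fst (\<omega> i),
               if Suc i mod N = n then Some (disc_return \<gamma> rew H M \<omega> i) else None,
               snd (\<omega> i))) [0..<m]"

definition aug ::
  "real \<Rightarrow> ('r \<Rightarrow> real) \<Rightarrow> nat \<Rightarrow> nat \<Rightarrow> nat \<Rightarrow> nat \<Rightarrow> ('a, 'o, 'r) history \<Rightarrow> ('a, 'o, 'r) aug_history" where
  "aug \<gamma> rew H M N n h = aug_outcome \<gamma> rew H M N n (\<lambda>i. h ! i) (length h)"

lemma aug_prefix:
  assumes "0 < H" "H \<le> N" "n = Suc m mod N"
  shows "aug \<gamma> rew H M N n (map \<omega> [0..<m]) = aug_outcome \<gamma> rew H M N n \<omega> m"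
proof -
  have "disc_return \<gamma> rew H M (\<lambda>i. map \<omega> [0..<m] ! i) i = disc_return \<gamma> rew H M \<omega> i"
    if i: "i < m" "Suc i mod N = n" for i
  proof -
    have "Suc i < Suc m" "Suc m mod N = Suc i mod N" using i assms by auto
    then have "N dvd Suc m - Suc i" by (metis mod_eq_dvd_iff_nat less_imp_le)
    then have "N \<le> m - i" using i by (intro dvd_imp_le) auto
    then have "i + k < m" if "k < H" for k using that assms by auto
    then show ?thesis by (simp add: disc_return_def ret_upto_def reward_at_def)
  qed
  then show ?thesis by (auto simp: aug_def aug_outcome_def)
qed

lemma disc_return_in_zvals:
  assumes "reward_structure rew" "0 < \<gamma>" "\<gamma> < 1" "0 < M"
  shows "disc_return \<gamma> rew H M \<omega> i \<in> zvals M"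
proof -
  let ?R = "ret_upto \<gamma> rew H \<omega> i"
  have r: "0 \<le> reward_at rew \<omega> j" "reward_at rew \<omega> j \<le> 1" for j
    using assms(1) by (force simp: reward_structure_def reward_at_def)+
  have "0 \<le> ?R" using assms r by (auto simp: ret_upto_def intro!: mult_nonneg_nonneg sum_nonneg)
  have "(\<Sum>k<H. \<gamma> ^ k * reward_at rew \<omega> (i + k)) \<le> (\<Sum>k<H. \<gamma> ^ k)"
    using assms r by (intro sum_mono) (auto intro!: mult_left_le)
  then have "?R \<le> (1 - \<gamma>) * (\<Sum>k<H. \<gamma> ^ k)"
    unfolding ret_upto_def using assms by (intro mult_left_mono) auto
  also have "\<dots> = 1 - \<gamma> ^ H" using one_diff_power_eq[of \<gamma> H] by simp
  also have "\<dots> < 1" using assms by simp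
  finally have "?R < 1" .
  have 1: "0 \<le> \<lfloor>real M * ?R\<rfloor>" using \<open>0 \<le> ?R\<close> by simp
  have "real M * ?R < real M" using \<open>?R < 1\<close> assms by simp
  then have "nat \<lfloor>real M * ?R\<rfloor> < M" using 1 by (simp add: nat_less_iff floor_less_iff)
  then show ?thesis using 1
    by (auto simp: zvals_def disc_return_def intro!: image_eqI[where x="nat \<lfloor>real M * ?R\<rfloor>"])
qed

text \<open>
  A predictor is a total function of which only the values at the \<open>(g, a)\<close> with
  \<open>pred_point M N n g\<close> are meaningful.
\<close>

type_synonym ('a, 'o, 'r) predictor = "('a, 'o, 'r) aug_history \<Rightarrow> 'a \<Rightarrow> real pmf"

definition pred_point :: "nat \<Rightarrow> nat \<Rightarrow> nat \<Rightarrow> ('a, 'o, 'r) aug_history \<Rightarrow> bool" where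
  "pred_point M N n g \<longleftrightarrow> g \<in> aug_hists M N n \<and> Suc (length g) mod N = n"

definition return_predictor :: "nat \<Rightarrow> nat \<Rightarrow> nat \<Rightarrow> ('a, 'o, 'r) predictor \<Rightarrow> bool" where
  "return_predictor M N n \<phi> \<longleftrightarrow> (\<forall>g a. pred_point M N n g \<longrightarrow> set_pmf (\<phi> g a) \<subseteq> zvals M)"

definition likelihood :: "nat \<Rightarrow> nat \<Rightarrow> ('a, 'o, 'r) predictor \<Rightarrow> ('a, 'o, 'r) aug_history \<Rightarrow> real" where
  "likelihood N n \<phi> g =
     (\<Prod>i\<in>{i. i < length g \<and> Suc i mod N = n}. pmf (\<phi> (take i g) (fst (g ! i))) (the (fst (snd (g ! i)))))"

definition mixture_predictor ::
  "nat \<Rightarrow> nat \<Rightarrow> nat \<Rightarrow> ('a, 'o, 'r) predictor set \<Rightarrow> ('a, 'o, 'r) predictor pmf \<Rightarrow>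
   ('a, 'o, 'r) predictor \<Rightarrow> bool" where
  "mixture_predictor M N n P w \<psi> \<longleftrightarrow>
     countable P \<and> (\<forall>\<phi>\<in>P. return_predictor M N n \<phi>) \<and> set_pmf w = P \<and>
     return_predictor M N n \<psi> \<and>
     (\<forall>g\<in>aug_hists M N n. ((\<lambda>\<phi>. pmf w \<phi> * likelihood N n \<phi> g) has_sum likelihood N n \<psi> g) P)"

definition unified ::
  "real \<Rightarrow> ('r \<Rightarrow> real) \<Rightarrow> nat \<Rightarrow> nat \<Rightarrow> nat \<Rightarrow> (nat \<Rightarrow> ('a, 'o, 'r) predictor) \<Rightarrow>
   ('a, 'o, 'r) history \<Rightarrow> 'a \<Rightarrow> real pmf" where
  "unified \<gamma> rew H M N \<psi> h a =
     (let n = Suc (length h) mod N in \<psi> n (aug \<gamma> rew H M N n h) a)"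

definition Q_hat ::
  "real \<Rightarrow> ('r \<Rightarrow> real) \<Rightarrow> nat \<Rightarrow> nat \<Rightarrow> nat \<Rightarrow> (nat \<Rightarrow> ('a, 'o, 'r) predictor) \<Rightarrow>
   ('a, 'o, 'r) history \<Rightarrow> 'a \<Rightarrow> real" where
  "Q_hat \<gamma> rew H M N \<psi> h a = (\<Sum>z\<in>zvals M. z * pmf (unified \<gamma> rew H M N \<psi> h a) z)"

definition aiqi_params :: "nat \<Rightarrow> nat \<Rightarrow> nat \<Rightarrow> real \<Rightarrow> bool" where
  "aiqi_params H M N \<tau> \<longleftrightarrow> 0 < H \<and> 0 < M \<and> H \<le> N \<and> 0 < \<tau> \<and> \<tau> \<le> 1"

text \<open>A predicate rather than a function, because ties may be broken stochastically (by \<open>p\<close>).\<close>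

definition aiqi_policy ::
  "real \<Rightarrow> ('r \<Rightarrow> real) \<Rightarrow> nat \<Rightarrow> nat \<Rightarrow> nat \<Rightarrow> real \<Rightarrow> (nat \<Rightarrow> ('a::finite, 'o, 'r) predictor) \<Rightarrow>
   ('a, 'o, 'r) policy \<Rightarrow> bool" where
  "aiqi_policy \<gamma> rew H M N \<tau> \<psi> \<pi> \<longleftrightarrow>
     (\<forall>h. \<exists>p. set_pmf p \<subseteq> {a. is_arg_max (Q_hat \<gamma> rew H M N \<psi> h) (\<lambda>_. True) a} \<and>
        (\<forall>a. pmf (\<pi> h) a = (1 - \<tau>) * pmf p a + \<tau> / real CARD('a)))"

text \<open>
  \<open>\<P> n\<close> is the class underlying the phase-\<open>n\<close> mixture and \<open>\<pi>\<close> the AIQI policy itself. Containing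
  the true predictor means containing a total function that agrees with it where predictors are
  meaningful.
\<close>

definition grain_of_truth ::
  "real \<Rightarrow> ('r \<Rightarrow> real) \<Rightarrow> nat \<Rightarrow> nat \<Rightarrow> nat \<Rightarrow> (nat \<Rightarrow> ('a::finite, 'o::finite, 'r::finite) predictor set) \<Rightarrow>
   ('a, 'o, 'r) policy \<Rightarrow> ('a, 'o, 'r) env \<Rightarrow> bool" where
  "grain_of_truth \<gamma> rew H M N \<P> \<pi> \<nu> \<longleftrightarrow>
     (\<forall>n<N. \<exists>\<phi>\<in>\<P> n. \<forall>g a. pred_point M N n g \<longrightarrow>
        (\<forall>z\<in>zvals M. pmf (\<phi> g a) z =
           measure (continue_from_act \<pi> \<nu> (strip g) a) {\<omega>. disc_return \<gamma> rew H M \<omega> 0 = z}))"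

end

theory Submission
  imports Defs
begin

text \<open>
  Call a nonnegative function of histories negligible if its expectations at times
  \<open>0, 1, \<dots>\<close> under \<open>\<nu>\<^sup>\<pi>\<close> are summable; such a function tends to 0 almost surely along
  the interaction. A Bayesian mixture that dominates the truth has summable expected squared
  prediction errors, because these are bounded by Kullback-Leibler divergences that telescope
  to at most \<open>ln (1 / w)\<close>. This applies to the return predictors, phase by phase, and to the
  percept predictions of \<open>\<xi>\<close> in place of \<open>\<nu>\<close>. Since \<open>\<pi>\<close> explores, negligible functions are
  stable under taking the worst action followed by an expectation over percepts; hence
  Bellman recursions propagate negligible errors even off the policy. Up to a negligible error,
  \<open>\<pi>\<close> is therefore greedy for its own action values in \<open>\<xi>\<close> within
  \<open>\<tau> + 1 / M + \<gamma> ^ H\<close> at every history, and the optimality recursion turns this into a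
  value gap of at most \<open>(\<tau> + 1 / M + \<gamma> ^ H) / (1 - \<gamma>)\<close>. The statement under \<open>\<xi>\<^sup>\<pi>\<close> follows
  because \<open>\<xi>\<^sup>\<pi>\<close> is the \<open>w\<close>-mixture of the \<open>\<nu>\<^sup>\<pi>\<close>.
\<close>

section \<open>Distributions of histories\<close>

lemma sets_cylinder:
  "{\<omega>. map \<omega> [0..<m] = h} \<in> sets (PiM UNIV (\<lambda>_. count_space (UNIV :: 'b::finite set)))"
proof (cases "length h = m")
  case True
  have eq: "{\<omega>. map \<omega> [0..<m] = h} =
      {\<omega> \<in> space (PiM UNIV (\<lambda>_::nat. count_space (UNIV :: 'b set))). \<forall>i\<in>{..<m}. \<omega> i = h ! i}"
    using True by (auto simp: space_PiM list_eq_iff_nth_eq)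
  show ?thesis unfolding eq by measurable
next
  case False
  then have "{\<omega> :: nat \<Rightarrow> 'b. map \<omega> [0..<m] = h} = {}" by auto
  then show ?thesis by simp
qed

lemma finite_length_eq: "finite {h :: 'b::finite list. length h = m}"
  using finite_lists_length_eq[of "UNIV :: 'b set" m] by simp

lemma measurable_prefix:
  "(\<lambda>\<omega>. map \<omega> [0..<m]) \<in>
    measurable (PiM UNIV (\<lambda>_. count_space (UNIV :: 'b::finite set))) (count_space UNIV)"
  using sets_cylinder countable_lists[of "UNIV :: 'b set"] countable_finite[of "UNIV :: 'b set"]
  by (subst measurable_count_space_eq_countable)
    (auto simp: vimage_def space_PiM simp del: map_eq_conv)

lemma emeasure_prefix:
  fixes \<mu> :: "(nat \<Rightarrow> 'b::finite) measure"
  assumes s: "sets \<mu> = sets (PiM UNIV (\<lambda>_. count_space UNIV))"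
  shows "emeasure \<mu> {\<omega>. map \<omega> [0..<m] \<in> S} =
    (\<Sum>h | h \<in> S \<and> length h = m. emeasure \<mu> {\<omega>. map \<omega> [0..<m] = h})"
proof -
  have fin: "finite {h :: 'b list. h \<in> S \<and> length h = m}"
    by (rule finite_subset[OF _ finite_length_eq[of m]]) auto
  have "{\<omega> :: nat \<Rightarrow> 'b. map \<omega> [0..<m] \<in> S} =
      (\<Union>h\<in>{h. h \<in> S \<and> length h = m}. {\<omega>. map \<omega> [0..<m] = h})" by auto
  then show ?thesis
    using fin by (simp only:)
      (rule sum_emeasure[symmetric], auto simp: disjoint_family_on_def s sets_cylinder)
qed

text \<open>Membership in a box over finitely many indices is decided by a long enough prefix, so
  the box is a finite disjoint union of cylinders; such boxes generate the product
  sigma-algebra.\<close>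

lemma measure_eqI_cylinder:
  fixes \<mu> \<mu>' :: "(nat \<Rightarrow> 'b::finite) measure"
  assumes s: "sets \<mu> = sets (PiM UNIV (\<lambda>_. count_space UNIV))"
    and s': "sets \<mu>' = sets (PiM UNIV (\<lambda>_. count_space UNIV))"
    and "finite_measure \<mu>"
    and eq: "\<And>h. emeasure \<mu> {\<omega>. map \<omega> [0..<length h] = h} = emeasure \<mu>' {\<omega>. map \<omega> [0..<length h] = h}"
  shows "\<mu> = \<mu>'"
proof (rule measure_eqI_PiM_infinite[OF s s'])
  fix A :: "nat \<Rightarrow> 'b set" and J :: "nat set" assume J: "finite J"
  \<comment> \<open>The inserted 0 keeps \<open>Max\<close> defined when \<open>J\<close> is
    empty.\<close>
  define m where "m = Suc (Max (insert 0 J))"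
  have m: "i \<in> J \<Longrightarrow> i < m" for i using J by (simp add: m_def less_Suc_eq_le)
  have "prod_emb UNIV (\<lambda>_. count_space UNIV) J (Pi\<^sub>E J A) =
      {\<omega>. map \<omega> [0..<m] \<in> {h. \<forall>i\<in>J. h ! i \<in> A i}}"
    using m by (auto simp: prod_emb_def space_PiM PiE_def Pi_def)
  then show "emeasure \<mu> (prod_emb UNIV (\<lambda>_. count_space UNIV) J (Pi\<^sub>E J A)) =
      emeasure \<mu>' (prod_emb UNIV (\<lambda>_. count_space UNIV) J (Pi\<^sub>E J A))"
    using eq by (auto simp only: emeasure_prefix[OF s] emeasure_prefix[OF s'] intro!: sum.cong)
qed fact

section \<open>Probabilities of finite histories\<close>

definition hist_prob :: "('a, 'o, 'r) policy \<Rightarrow> ('a, 'o, 'r) env \<Rightarrow> ('a, 'o, 'r) history \<Rightarrow> real" where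
  "hist_prob \<pi> \<nu> h = (\<Prod>i<length h. pmf (step_pmf \<pi> \<nu> (take i h)) (h ! i))"

lemma hist_prob_Nil [simp]: "hist_prob \<pi> \<nu> [] = 1"
  by (simp add: hist_prob_def)

lemma hist_prob_snoc: "hist_prob \<pi> \<nu> (h @ [b]) = hist_prob \<pi> \<nu> h * pmf (step_pmf \<pi> \<nu> h) b"
  by (auto simp: hist_prob_def nth_append intro!: prod.cong)

lemma hist_prob_nonneg: "0 \<le> hist_prob \<pi> \<nu> h"
  by (simp add: hist_prob_def prod_nonneg)

lemma step_pmf_shift: "step_pmf (\<lambda>g. \<pi> (h @ g)) (\<lambda>g. \<nu> (h @ g)) g = step_pmf \<pi> \<nu> (h @ g)"
  by (simp add: step_pmf_def)

text \<open>Chain rule: what follows \<open>h\<close> is weighted as in the interaction restarted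
  with shifted policy and environment, which is how \<open>continue_from\<close> conditions.\<close>

lemma hist_prob_append:
  "hist_prob \<pi> \<nu> (h @ g) = hist_prob \<pi> \<nu> h * hist_prob (\<lambda>g. \<pi> (h @ g)) (\<lambda>g. \<nu> (h @ g)) g"
proof (induction g rule: rev_induct)
  case (snoc b g)
  then show ?case
    by (simp add: hist_prob_snoc step_pmf_shift flip: append_assoc)
qed simp

lemma emeasure_interaction_cylinder:
  fixes \<pi> :: "('a::finite, 'o::finite, 'r::finite) policy"
  shows "emeasure (interaction \<pi> \<nu>) {\<omega>. map \<omega> [0..<length h] = h} = ennreal (hist_prob \<pi> \<nu> h)"
proof -
  interpret prob_space "interaction \<pi> \<nu>" by (rule prob_space_interaction)
  show ?thesis
    unfolding emeasure_eq_measure interaction_cylinder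
    by (auto simp: hist_prob_def pmf_step_pmf[symmetric])
qed

lemma interaction_eqI:
  fixes \<pi> :: "('a::finite, 'o::finite, 'r::finite) policy"
  assumes s: "sets \<mu> = sets (PiM UNIV (\<lambda>_. count_space UNIV))"
    and eq: "\<And>h. emeasure \<mu> {\<omega>. map \<omega> [0..<length h] = h} = ennreal (hist_prob \<pi> \<nu> h)"
  shows "interaction \<pi> \<nu> = \<mu>"
  using prob_space_interaction prob_space.finite_measure
  by (intro measure_eqI_cylinder sets_interaction s)
    (auto simp only: eq emeasure_interaction_cylinder)

lemma measure_interaction_prefix:
  fixes \<pi> :: "('a::finite, 'o::finite, 'r::finite) policy"
  shows "measure (interaction \<pi> \<nu>) {\<omega>. map \<omega> [0..<m] \<in> S} =
    (\<Sum>h | h \<in> S \<and> length h = m. hist_prob \<pi> \<nu> h)"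
proof -
  have "emeasure (interaction \<pi> \<nu>) {\<omega>. map \<omega> [0..<m] \<in> S} =
      (\<Sum>h | h \<in> S \<and> length h = m. ennreal (hist_prob \<pi> \<nu> h))"
    unfolding emeasure_prefix[OF sets_interaction]
    by (rule sum.cong) (auto simp flip: emeasure_interaction_cylinder)
  then show ?thesis
    by (simp add: measure_def hist_prob_nonneg sum_nonneg)
qed

lemma sum_hist_prob:
  fixes \<pi> :: "('a::finite, 'o::finite, 'r::finite) policy"
  shows "(\<Sum>h | length h = m. hist_prob \<pi> \<nu> h) = 1"
proof -
  interpret prob_space "interaction \<pi> \<nu>" by (rule prob_space_interaction)
  show ?thesis
    using measure_interaction_prefix[of \<pi> \<nu> m UNIV] prob_space by simp
qed

lemma nn_integral_prefix:
  fixes \<pi> :: "('a::finite, 'o::finite, 'r::finite) policy"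
  assumes "\<And>h. 0 \<le> f h"
  shows "(\<integral>\<^sup>+\<omega>. ennreal (f (map \<omega> [0..<m])) \<partial>interaction \<pi> \<nu>) =
    ennreal (\<Sum>h | length h = m. hist_prob \<pi> \<nu> h * f h)"
proof -
  have fin: "finite {h :: ('a, 'o, 'r) history. length h = m}"
    by (rule finite_length_eq)
  have "(\<integral>\<^sup>+\<omega>. ennreal (f (map \<omega> [0..<m])) \<partial>interaction \<pi> \<nu>) =
      (\<integral>\<^sup>+\<omega>. (\<Sum>h | length h = m. ennreal (f h) * indicator {\<omega>. map \<omega> [0..<m] = h} \<omega>) \<partial>interaction \<pi> \<nu>)"
  proof (rule nn_integral_cong)
    fix \<omega> :: "('a, 'o, 'r) outcome"
    \<comment> \<open>For a fixed outcome, only its own prefix contributes to the sum.\<close>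
    have "(\<Sum>h | length h = m. ennreal (f h) * indicator {\<omega>. map \<omega> [0..<m] = h} \<omega>) =
        (\<Sum>h\<in>{map \<omega> [0..<m]}. ennreal (f h))"
      using fin by (intro sum.mono_neutral_cong_right) auto
    then show "ennreal (f (map \<omega> [0..<m])) =
        (\<Sum>h | length h = m. ennreal (f h) * indicator {\<omega>. map \<omega> [0..<m] = h} \<omega>)" by simp
  qed
  also have "\<dots> = (\<Sum>h | length h = m. ennreal (f h) * emeasure (interaction \<pi> \<nu>) {\<omega>. map \<omega> [0..<m] = h})"
    by (subst nn_integral_sum)
      (auto simp: sets_interaction sets_cylinder nn_integral_cmult_indicator
        intro!: borel_measurable_times_ennreal borel_measurable_indicator)
  also have "\<dots> = (\<Sum>h | length h = m. ennreal (hist_prob \<pi> \<nu> h * f h))"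
    using assms
    by (intro sum.cong refl) (auto simp: emeasure_interaction_cylinder ennreal_mult' mult.commute hist_prob_nonneg)
  also have "\<dots> = ennreal (\<Sum>h | length h = m. hist_prob \<pi> \<nu> h * f h)"
    using assms hist_prob_nonneg by (intro sum_ennreal mult_nonneg_nonneg)
  finally show ?thesis .
qed

section \<open>Decomposition of the interaction at its first block\<close>

lemma measurable_case_nat_shift:
  "case_nat b \<in> measurable (PiM UNIV (\<lambda>_. count_space UNIV)) (PiM UNIV (\<lambda>_. count_space (UNIV :: 'b set)))"
proof (rule measurable_PiM_single')
  fix i :: nat
  show "(\<lambda>\<omega>. case_nat b \<omega> i) \<in> measurable (PiM UNIV (\<lambda>_. count_space UNIV)) (count_space (UNIV :: 'b set))"
    by (cases i) simp_all
qed (auto simp: space_PiM)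

lemma map_case_nat: "map (case_nat b \<omega>) [0..<Suc m] = b # map \<omega> [0..<m]"
  by (simp add: map_upt_Suc del: upt_Suc)

text \<open>Every set is measurable for a pmf, so a kernel out of it needs no regularity beyond
  having probability measures on \<open>N\<close> as values.\<close>

lemma subprob_measurable_pmf:
  assumes "\<And>x. sets (K x) = sets N" "\<And>x. prob_space (K x)"
  shows "K \<in> measurable (measure_pmf p) (subprob_algebra N)"
proof -
  have "K \<in> measurable (count_space UNIV) (subprob_algebra N)"
    using assms prob_space_imp_subprob_space by (auto simp: space_subprob_algebra)
  then show ?thesis by (simp add: measurable_cong_sets)
qed

text \<open>Draw the first block, run the shifted interaction, prepend the block. The identity is
  checked on cylinders, which determine the measure.\<close>

lemma interaction_step:
  fixes \<pi> :: "('a::finite, 'o::finite, 'r::finite) policy"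
  shows "interaction \<pi> \<nu> = measure_pmf (step_pmf \<pi> \<nu> []) \<bind>
    (\<lambda>b. distr (interaction (\<lambda>g. \<pi> (b # g)) (\<lambda>g. \<nu> (b # g)))
      (PiM UNIV (\<lambda>_. count_space UNIV)) (case_nat b))"
    (is "_ = measure_pmf ?s \<bind> ?K")
proof (rule interaction_eqI)
  have meas: "case_nat b \<in> measurable (interaction \<pi>' \<nu>') (PiM UNIV (\<lambda>_. count_space UNIV))" for b and \<pi>' :: "('a, 'o, 'r) policy" and \<nu>'
    using measurable_case_nat_shift by (simp add: measurable_cong_sets[OF sets_interaction refl])
  have K: "?K \<in> measurable ?s (subprob_algebra (PiM UNIV (\<lambda>_. count_space UNIV)))"
    by (rule subprob_measurable_pmf)
      (auto intro: prob_space.prob_space_distr prob_space_interaction meas)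
  show s: "sets (measure_pmf ?s \<bind> ?K) = sets (PiM UNIV (\<lambda>_. count_space UNIV))"
    by (rule sets_bind) auto
  have emeasure1: "emeasure (interaction \<pi>' \<nu>') UNIV = 1" for \<pi>' :: "('a, 'o, 'r) policy" and \<nu>'
    using prob_space.emeasure_space_1[OF prob_space_interaction[of \<pi>' \<nu>']] by simp
  fix h :: "('a, 'o, 'r) history"
  have E: "emeasure (measure_pmf ?s \<bind> ?K) {\<omega>. map \<omega> [0..<length h] = h} =
      (\<integral>\<^sup>+b. emeasure (interaction (\<lambda>g. \<pi> (b # g)) (\<lambda>g. \<nu> (b # g)))
        {\<omega>. map (case_nat b \<omega>) [0..<length h] = h} \<partial>?s)"
    by (subst emeasure_bind[OF _ K sets_cylinder])
      (auto simp: emeasure_distr[OF meas sets_cylinder] vimage_def intro!: nn_integral_cong simp del: map_eq_conv)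
  \<comment> \<open>The empty history asks for the total mass. For a nonempty one the drawn block
    must equal its head, so the integral reduces to one atom and the chain rule applies.\<close>
  show "emeasure (measure_pmf ?s \<bind> ?K) {\<omega>. map \<omega> [0..<length h] = h} = ennreal (hist_prob \<pi> \<nu> h)"
  proof (cases h)
    case Nil
    then show ?thesis
      unfolding E using emeasure1 by simp
  next
    case (Cons c g)
    have "emeasure (interaction (\<lambda>g. \<pi> (b # g)) (\<lambda>g. \<nu> (b # g))) {\<omega>. map (case_nat b \<omega>) [0..<length h] = h} =
        ennreal (hist_prob (\<lambda>g. \<pi> (c # g)) (\<lambda>g. \<nu> (c # g)) g) * indicator {c} b" for b
      using emeasure_interaction_cylinder[of "\<lambda>g. \<pi> (c # g)" "\<lambda>g. \<nu> (c # g)" g]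
      by (cases "b = c") (simp_all add: Cons map_case_nat del: upt_Suc map_eq_conv)
    then have "emeasure (measure_pmf ?s \<bind> ?K) {\<omega>. map \<omega> [0..<length h] = h} =
        ennreal (hist_prob (\<lambda>g. \<pi> (c # g)) (\<lambda>g. \<nu> (c # g)) g) * ennreal (pmf ?s c)"
      unfolding E by (simp add: nn_integral_cmult_indicator emeasure_pmf_single)
    also have "\<dots> = ennreal (hist_prob \<pi> \<nu> h)"
      using hist_prob_append[of \<pi> \<nu> "[c]" g] hist_prob_snoc[of \<pi> \<nu> "[]" c]
      by (simp add: Cons ennreal_mult hist_prob_nonneg mult.commute)
    finally show ?thesis .
  qed
qed

lemma integral_interaction_step:
  fixes \<pi> :: "('a::finite, 'o::finite, 'r::finite) policy"
  assumes f: "f \<in> borel_measurable (PiM UNIV (\<lambda>_. count_space UNIV))" and B: "\<And>\<omega>. \<bar>f \<omega>\<bar> \<le> B"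
  shows "(\<integral>\<omega>. f \<omega> \<partial>interaction \<pi> \<nu>) =
    (\<Sum>b\<in>UNIV. pmf (step_pmf \<pi> \<nu> []) b *
      (\<integral>\<omega>. f (case_nat b \<omega>) \<partial>interaction (\<lambda>g. \<pi> (b # g)) (\<lambda>g. \<nu> (b # g))))"
    (is "_ = ?rhs")
proof -
  have meas: "case_nat b \<in> measurable (interaction \<pi>' \<nu>') (PiM UNIV (\<lambda>_. count_space UNIV))" for b and \<pi>' :: "('a, 'o, 'r) policy" and \<nu>'
    using measurable_case_nat_shift by (simp add: measurable_cong_sets[OF sets_interaction refl])
  have "(\<integral>\<omega>. f \<omega> \<partial>interaction \<pi> \<nu>) = (\<integral>b. (\<integral>\<omega>. f \<omega> \<partial>distr (interaction (\<lambda>g. \<pi> (b # g)) (\<lambda>g. \<nu> (b # g)))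
      (PiM UNIV (\<lambda>_. count_space UNIV)) (case_nat b)) \<partial>step_pmf \<pi> \<nu> [])"
    unfolding interaction_step[of \<pi> \<nu>]
  proof (rule integral_bind[OF f])
    show "(\<lambda>b. distr (interaction (\<lambda>g. \<pi> (b # g)) (\<lambda>g. \<nu> (b # g))) (PiM UNIV (\<lambda>_. count_space UNIV)) (case_nat b))
        \<in> measurable (step_pmf \<pi> \<nu> []) (subprob_algebra (PiM UNIV (\<lambda>_. count_space UNIV)))"
      by (rule subprob_measurable_pmf)
        (auto intro: prob_space.prob_space_distr prob_space_interaction meas)
    have "emeasure (distr (interaction \<pi>' \<nu>') (PiM UNIV (\<lambda>_. count_space UNIV)) (case_nat b))
        (space (distr (interaction \<pi>' \<nu>') (PiM UNIV (\<lambda>_. count_space UNIV)) (case_nat b))) \<le> ennreal 1"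
      for b and \<pi>' :: "('a, 'o, 'r) policy" and \<nu>'
      using prob_space.emeasure_space_1[OF prob_space.prob_space_distr[OF prob_space_interaction meas, of \<pi>' \<nu>' b]]
      by simp
    then show "AE b in step_pmf \<pi> \<nu> []. emeasure (distr (interaction (\<lambda>g. \<pi> (b # g)) (\<lambda>g. \<nu> (b # g)))
        (PiM UNIV (\<lambda>_. count_space UNIV)) (case_nat b))
        (space (distr (interaction (\<lambda>g. \<pi> (b # g)) (\<lambda>g. \<nu> (b # g))) (PiM UNIV (\<lambda>_. count_space UNIV)) (case_nat b)))
        \<le> ennreal 1"
      by blast
  qed (use B measure_pmf.finite_measure_axioms in auto)
  also have "\<dots> = ?rhs"
    by (subst integral_measure_pmf_real[of UNIV]) (auto simp: integral_distr[OF meas f] mult.commute)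
  finally show ?thesis .
qed

section \<open>Values and Bellman equations\<close>

text \<open>The one-step Bellman operator. As \<open>V\<close> is arbitrary, it yields the action
  values both of a fixed policy and of the optimum, in any environment.\<close>

definition backup ::
  "real \<Rightarrow> ('r::finite \<Rightarrow> real) \<Rightarrow> ('a::finite, 'o::finite, 'r) env \<Rightarrow> (('a, 'o, 'r) history \<Rightarrow> real) \<Rightarrow>
   ('a, 'o, 'r) history \<Rightarrow> 'a \<Rightarrow> real" where
  "backup \<gamma> rew \<nu> V h a =
     (\<Sum>e\<in>UNIV. pmf (\<nu> h a) e * ((1 - \<gamma>) * rew (snd e) + \<gamma> * V (h @ [(a, e)])))"

lemma sum_pmf_UNIV: "(\<Sum>x\<in>UNIV. pmf p (x :: 'x::finite)) = 1"
  by (rule sum_pmf_eq_1) auto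

lemma expectation_le:
  fixes p :: "'x::finite pmf"
  assumes "\<And>x. f x \<le> c"
  shows "(\<Sum>x\<in>UNIV. pmf p x * f x) \<le> c"
proof -
  have "(\<Sum>x\<in>UNIV. pmf p x * f x) \<le> (\<Sum>x\<in>UNIV. pmf p x * c)"
    by (intro sum_mono mult_left_mono assms) auto
  then show ?thesis by (simp add: sum_distrib_right[symmetric] sum_pmf_UNIV)
qed

text \<open>This replaces the average over the actions of a policy by a single action, the form in
  which recursions are later unrolled.\<close>

lemma expectation_le_max:
  fixes p :: "'x::finite pmf"
  shows "\<exists>x. (\<Sum>y\<in>UNIV. pmf p y * f y) \<le> f x"
proof -
  have "f y \<le> Max (range f)" for y by simp
  then have "(\<Sum>y\<in>UNIV. pmf p y * f y) \<le> Max (range f)" by (rule expectation_le)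
  moreover have "Max (range f) \<in> range f" by (rule Max_in) auto
  ultimately show ?thesis by (metis rangeE)
qed

lemma integrable_interaction:
  fixes \<pi> :: "('a::finite, 'o::finite, 'r::finite) policy" and f :: "('a, 'o, 'r) outcome \<Rightarrow> real"
  assumes "f \<in> borel_measurable (PiM UNIV (\<lambda>_. count_space UNIV))" "\<And>\<omega>. \<bar>f \<omega>\<bar> \<le> B"
  shows "integrable (interaction \<pi> \<nu>) f"
proof -
  interpret prob_space "interaction \<pi> \<nu>" by (rule prob_space_interaction)
  show ?thesis
    using assms by (intro integrable_const_bound[of _ B]) (auto simp: measurable_cong_sets[OF sets_interaction refl])
qed

lemma finite_zvals [simp]: "finite (zvals M)"
  by (simp add: zvals_def)

lemma zvals_bounds: "z \<in> zvals M \<Longrightarrow> 0 \<le> z \<and> z \<le> 1"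
  by (auto simp: zvals_def)

locale discounted =
  fixes \<gamma> :: real and rew :: "'r::finite \<Rightarrow> real"
  assumes rew: "reward_structure rew" and \<gamma>_pos: "0 < \<gamma>" and \<gamma>_less: "\<gamma> < 1"
begin

lemma rew_bounds: "0 \<le> rew x" "rew x \<le> 1"
  using rew by (auto simp: reward_structure_def image_subset_iff)

lemma reward_at_bounds: "0 \<le> reward_at rew \<omega> i" "reward_at rew \<omega> i \<le> 1"
  by (simp_all add: reward_at_def rew_bounds)

lemma abs_reward_at_le: "\<bar>reward_at rew \<omega> i\<bar> \<le> 1"
  using reward_at_bounds[of \<omega> i] by simp

lemma summable_discounted: "summable (\<lambda>k. \<gamma> ^ k * reward_at rew \<omega> (i + k))"
proof (rule summable_comparison_test')
  show "summable (\<lambda>k. \<gamma> ^ k)" using \<gamma>_pos \<gamma>_less by (intro summable_geometric) auto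
  show "norm (\<gamma> ^ k * reward_at rew \<omega> (i + k)) \<le> \<gamma> ^ k" for k
    using \<gamma>_pos abs_reward_at_le by (simp add: abs_mult mult_left_le)
qed

lemma ret_upto_le_ret: "ret_upto \<gamma> rew H \<omega> i \<le> ret \<gamma> rew \<omega> i"
  unfolding ret_upto_def ret_def using \<gamma>_pos \<gamma>_less reward_at_bounds
  by (intro mult_left_mono sum_le_suminf summable_discounted) (auto intro!: mult_nonneg_nonneg)

text \<open>Rewards are at most 1, and the geometric tail from \<open>H\<close> on, scaled by
  \<open>1 - \<gamma>\<close>, equals \<open>\<gamma> ^ H\<close>.\<close>

lemma ret_le_ret_upto: "ret \<gamma> rew \<omega> i \<le> ret_upto \<gamma> rew H \<omega> i + \<gamma> ^ H"
proof -
  have "(\<Sum>k. \<gamma> ^ (k + H) * reward_at rew \<omega> (i + (k + H))) \<le> (\<Sum>k. \<gamma> ^ (k + H))"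
    using \<gamma>_pos \<gamma>_less reward_at_bounds
    by (intro suminf_le summable_ignore_initial_segment summable_discounted summable_geometric)
      (auto intro!: mult_left_le)
  also have "\<dots> = \<gamma> ^ H / (1 - \<gamma>)"
    using suminf_mult2[OF summable_geometric[of \<gamma>], of "\<gamma> ^ H"] suminf_geometric[of \<gamma>] \<gamma>_pos \<gamma>_less
    by (simp add: power_add)
  finally have "(1 - \<gamma>) * (\<Sum>k. \<gamma> ^ (k + H) * reward_at rew \<omega> (i + (k + H))) \<le> \<gamma> ^ H"
    using \<gamma>_less by (simp add: pos_le_divide_eq mult.commute)
  then show ?thesis
    unfolding ret_def ret_upto_def suminf_split_initial_segment[OF summable_discounted[of \<omega> i], of H] distrib_left
    by simp
qed

text \<open>These are the truncation bounds at horizon 0, where the truncated return vanishes and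
  the error term is 1.\<close>

lemma ret_bounds: "0 \<le> ret \<gamma> rew \<omega> i" "ret \<gamma> rew \<omega> i \<le> 1"
  using ret_upto_le_ret[of 0 \<omega> i] ret_le_ret_upto[of \<omega> i 0] by (simp_all add: ret_upto_def)

lemma abs_ret_le: "\<bar>ret \<gamma> rew \<omega> i\<bar> \<le> 1"
  using ret_bounds[of \<omega> i] by simp

lemma ret_case_nat:
  "ret \<gamma> rew (case_nat b \<omega>) 0 = (1 - \<gamma>) * rew (snd (snd b)) + \<gamma> * ret \<gamma> rew \<omega> 0"
proof -
  have "(\<Sum>k. \<gamma> ^ k * reward_at rew (case_nat b \<omega>) k) =
      reward_at rew (case_nat b \<omega>) 0 + (\<Sum>k. \<gamma> ^ Suc k * reward_at rew (case_nat b \<omega>) (Suc k))"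
    using suminf_split_initial_segment[OF summable_discounted[of "case_nat b \<omega>" 0], of 1] by simp
  also have "(\<Sum>k. \<gamma> ^ Suc k * reward_at rew (case_nat b \<omega>) (Suc k)) = \<gamma> * (\<Sum>k. \<gamma> ^ k * reward_at rew \<omega> k)"
    using suminf_mult[OF summable_discounted[of \<omega> 0], of \<gamma>] by (simp add: reward_at_def mult.assoc)
  finally show ?thesis by (simp add: ret_def reward_at_def algebra_simps)
qed

lemma measurable_reward_at [measurable]:
  "(\<lambda>\<omega>. reward_at rew \<omega> i) \<in> borel_measurable (PiM UNIV (\<lambda>_. count_space (UNIV :: ('a \<times> 'o \<times> 'r) set)))"
  unfolding reward_at_def
  by (rule measurable_compose[OF measurable_component_singleton]) auto

lemma measurable_ret:
  "(\<lambda>\<omega>. ret \<gamma> rew \<omega> i) \<in> borel_measurable (PiM UNIV (\<lambda>_. count_space (UNIV :: ('a \<times> 'o \<times> 'r) set)))"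
  unfolding ret_def by measurable

lemma measurable_disc_return:
  "(\<lambda>\<omega>. disc_return \<gamma> rew H M \<omega> i) \<in> borel_measurable (PiM UNIV (\<lambda>_. count_space (UNIV :: ('a \<times> 'o \<times> 'r) set)))"
  unfolding disc_return_def ret_upto_def by measurable

lemma integrable_ret:
  fixes \<pi> :: "('a::finite, 'o::finite, 'r) policy"
  shows "integrable (interaction \<pi> \<nu>) (\<lambda>\<omega>. ret \<gamma> rew \<omega> i)"
  by (rule integrable_interaction[OF measurable_ret abs_ret_le])

lemma integral_ret_step:
  fixes \<pi> :: "('a::finite, 'o::finite, 'r) policy"
  shows "(\<integral>\<omega>. ret \<gamma> rew \<omega> 0 \<partial>interaction \<pi> \<nu>) =
    (\<Sum>a\<in>UNIV. pmf (\<pi> []) a * (\<Sum>e\<in>UNIV. pmf (\<nu> [] a) e * ((1 - \<gamma>) * rew (snd e) +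
      \<gamma> * (\<integral>\<omega>. ret \<gamma> rew \<omega> 0 \<partial>interaction (\<lambda>g. \<pi> ((a, e) # g)) (\<lambda>g. \<nu> ((a, e) # g))))))"
proof -
  have "(\<integral>\<omega>. ret \<gamma> rew \<omega> 0 \<partial>interaction \<pi> \<nu>) = (\<Sum>b\<in>UNIV. pmf (step_pmf \<pi> \<nu> []) b *
      (\<integral>\<omega>. ret \<gamma> rew (case_nat b \<omega>) 0 \<partial>interaction (\<lambda>g. \<pi> (b # g)) (\<lambda>g. \<nu> (b # g))))"
    by (rule integral_interaction_step[OF measurable_ret abs_ret_le])
  also have "\<dots> = (\<Sum>b\<in>UNIV. pmf (step_pmf \<pi> \<nu> []) b * ((1 - \<gamma>) * rew (snd (snd b)) +
      \<gamma> * (\<integral>\<omega>. ret \<gamma> rew \<omega> 0 \<partial>interaction (\<lambda>g. \<pi> (b # g)) (\<lambda>g. \<nu> (b # g)))))"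
    unfolding ret_case_nat
    by (intro sum.cong refl, subst Bochner_Integration.integral_add)
      (auto simp: integrable_ret prob_space.prob_space[OF prob_space_interaction, simplified]
        intro!: finite_measure.integrable_const prob_space.finite_measure prob_space_interaction)
  also have "\<dots> = (\<Sum>(a, e)\<in>UNIV \<times> UNIV. pmf (\<pi> []) a * (pmf (\<nu> [] a) e * ((1 - \<gamma>) * rew (snd e) +
      \<gamma> * (\<integral>\<omega>. ret \<gamma> rew \<omega> 0 \<partial>interaction (\<lambda>g. \<pi> ((a, e) # g)) (\<lambda>g. \<nu> ((a, e) # g))))))"
    by (intro sum.cong) (auto simp: pmf_step_pmf mult.assoc)
  finally show ?thesis
    unfolding sum.cartesian_product[symmetric] sum_distrib_left .
qed

text \<open>Bellman equation of a policy. It holds at every history, reachable or not, because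
  conditioning means restarting the interaction.\<close>

lemma policy_value_step:
  fixes \<pi> :: "('a::finite, 'o::finite, 'r) policy"
  shows "policy_value \<gamma> rew \<pi> \<nu> h =
    (\<Sum>a\<in>UNIV. pmf (\<pi> h) a * backup \<gamma> rew \<nu> (policy_value \<gamma> rew \<pi> \<nu>) h a)"
  unfolding policy_value_def continue_from_def backup_def by (subst integral_ret_step) simp

lemma policy_value_bounds:
  fixes \<pi> :: "('a::finite, 'o::finite, 'r) policy"
  shows "0 \<le> policy_value \<gamma> rew \<pi> \<nu> h" "policy_value \<gamma> rew \<pi> \<nu> h \<le> 1"
proof -
  let ?P = "continue_from \<pi> \<nu> h"
  interpret prob_space ?P unfolding continue_from_def by (rule prob_space_interaction)
  show "0 \<le> policy_value \<gamma> rew \<pi> \<nu> h"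
    unfolding policy_value_def by (intro Bochner_Integration.integral_nonneg) (simp add: ret_bounds)
  show "policy_value \<gamma> rew \<pi> \<nu> h \<le> 1"
    unfolding policy_value_def
    by (rule integral_le_const) (auto simp: ret_bounds continue_from_def integrable_ret)
qed

text \<open>The first action is a point mass, so the sum over actions collapses; this identifies
  \<open>backup\<close> of the policy value with the action value.\<close>

lemma integral_ret_continue_from_act:
  fixes \<pi> :: "('a::finite, 'o::finite, 'r) policy"
  shows "(\<integral>\<omega>. ret \<gamma> rew \<omega> 0 \<partial>continue_from_act \<pi> \<nu> h a) = backup \<gamma> rew \<nu> (policy_value \<gamma> rew \<pi> \<nu>) h a"
  unfolding policy_value_def continue_from_act_def continue_from_def backup_def
  by (subst integral_ret_step) (simp add: pmf_return indicator_def of_bool_def if_distrib[of "\<lambda>x. x * _"] cong: if_cong)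

lemma backup_bounds:
  assumes "\<And>g. 0 \<le> V g" "\<And>g. V g \<le> 1"
  shows "0 \<le> backup \<gamma> rew \<nu> V h a" "backup \<gamma> rew \<nu> V h a \<le> 1"
proof -
  show "0 \<le> backup \<gamma> rew \<nu> V h a"
    unfolding backup_def using assms rew_bounds \<gamma>_pos \<gamma>_less by (intro sum_nonneg) auto
  have "(1 - \<gamma>) * rew x + \<gamma> * V g \<le> (1 - \<gamma>) * 1 + \<gamma> * 1" for x g
    using assms rew_bounds \<gamma>_pos \<gamma>_less by (intro add_mono mult_left_mono) auto
  then show "backup \<gamma> rew \<nu> V h a \<le> 1"
    unfolding backup_def by (intro expectation_le) simp
qed

lemma backup_mono:
  assumes "\<And>g. V g \<le> W g"
  shows "backup \<gamma> rew \<nu> V h a \<le> backup \<gamma> rew \<nu> W h a"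
  unfolding backup_def using assms \<gamma>_pos by (intro sum_mono mult_left_mono add_mono order_refl) auto

lemma policy_value_le_opt_value:
  fixes \<nu> :: "('a::finite, 'o::finite, 'r) env"
  shows "policy_value \<gamma> rew \<pi> \<nu> h \<le> opt_value \<gamma> rew \<nu> h"
  unfolding opt_value_def by (rule cSUP_upper) (auto intro!: bdd_aboveI[of _ 1] policy_value_bounds)

lemma opt_value_bounds:
  fixes \<nu> :: "('a::finite, 'o::finite, 'r) env"
  shows "0 \<le> opt_value \<gamma> rew \<nu> h" "opt_value \<gamma> rew \<nu> h \<le> 1"
proof -
  show "0 \<le> opt_value \<gamma> rew \<nu> h"
    using policy_value_bounds(1) policy_value_le_opt_value by (rule order_trans)
  show "opt_value \<gamma> rew \<nu> h \<le> 1"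
    unfolding opt_value_def by (rule cSUP_least) (auto intro: policy_value_bounds)
qed

text \<open>The upper half of the Bellman optimality equation. The value of any policy is an average
  of backups of its own value; these are at most the backups of the optimal value, hence at most the
  largest of those over the finitely many actions.\<close>

lemma opt_value_le_backup:
  fixes \<nu> :: "('a::finite, 'o::finite, 'r) env"
  shows "\<exists>a. opt_value \<gamma> rew \<nu> h \<le> backup \<gamma> rew \<nu> (opt_value \<gamma> rew \<nu>) h a"
proof -
  let ?f = "backup \<gamma> rew \<nu> (opt_value \<gamma> rew \<nu>) h"
  have "opt_value \<gamma> rew \<nu> h \<le> Max (range ?f)"
    unfolding opt_value_def[of _ _ _ h]
  proof (rule cSUP_least)
    fix \<pi> :: "('a, 'o, 'r) policy"
    have "backup \<gamma> rew \<nu> (policy_value \<gamma> rew \<pi> \<nu>) h a \<le> Max (range ?f)" for a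
      by (rule order_trans[OF backup_mono[OF policy_value_le_opt_value]]) simp
    then show "policy_value \<gamma> rew \<pi> \<nu> h \<le> Max (range ?f)"
      unfolding policy_value_step[of \<pi> \<nu> h] by (rule expectation_le)
  qed simp
  moreover have "Max (range ?f) \<in> range ?f" by (rule Max_in) auto
  ultimately show ?thesis by (metis rangeE)
qed

text \<open>Truncation loses at most \<open>\<gamma> ^ H\<close> and rounding down at most
  \<open>1 / M\<close>. Both only lower the return, so the error is one-sided.\<close>

lemma disc_return_bounds:
  assumes "0 < M"
  shows "disc_return \<gamma> rew H M \<omega> i \<le> ret \<gamma> rew \<omega> i"
    and "ret \<gamma> rew \<omega> i \<le> disc_return \<gamma> rew H M \<omega> i + (1 / real M + \<gamma> ^ H)"
proof -
  let ?R = "ret_upto \<gamma> rew H \<omega> i"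
  have "disc_return \<gamma> rew H M \<omega> i \<le> ?R"
    using assms of_int_floor_le[of "real M * ?R"] by (simp add: disc_return_def divide_le_eq mult.commute)
  then show "disc_return \<gamma> rew H M \<omega> i \<le> ret \<gamma> rew \<omega> i" using ret_upto_le_ret by (rule order_trans)
  have "real M * ?R \<le> real_of_int \<lfloor>real M * ?R\<rfloor> + 1" by linarith
  then have "?R \<le> disc_return \<gamma> rew H M \<omega> i + 1 / real M"
    using assms by (simp add: disc_return_def field_simps)
  then show "ret \<gamma> rew \<omega> i \<le> disc_return \<gamma> rew H M \<omega> i + (1 / real M + \<gamma> ^ H)"
    using ret_le_ret_upto[of \<omega> i H] by simp
qed

lemma expected_disc_return_bounds:
  fixes \<pi> :: "('a::finite, 'o::finite, 'r) policy" and \<nu> :: "('a, 'o, 'r) env" and h a and H M :: nat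
  assumes M: "0 < M"
  defines "q \<equiv> (\<Sum>z\<in>zvals M. z * measure (continue_from_act \<pi> \<nu> h a) {\<omega>. disc_return \<gamma> rew H M \<omega> 0 = z})"
  shows "q \<le> backup \<gamma> rew \<nu> (policy_value \<gamma> rew \<pi> \<nu>) h a"
    and "backup \<gamma> rew \<nu> (policy_value \<gamma> rew \<pi> \<nu>) h a \<le> q + (1 / real M + \<gamma> ^ H)"
proof -
  let ?P = "continue_from_act \<pi> \<nu> h a"
  interpret prob_space ?P unfolding continue_from_act_def by (rule prob_space_interaction)
  note zv = disc_return_in_zvals[OF rew \<gamma>_pos \<gamma>_less M]
  have meas: "(\<lambda>\<omega>. disc_return \<gamma> rew H M \<omega> 0) \<in> borel_measurable ?P"
    using measurable_disc_return by (simp add: continue_from_act_def measurable_cong_sets[OF sets_interaction refl])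
  have sets: "{\<omega>. disc_return \<gamma> rew H M \<omega> 0 = z} \<in> sets ?P" for z
    using measurable_sets[OF meas, of "{z}"] by (simp add: vimage_def continue_from_act_def)
  have int: "integrable ?P (\<lambda>\<omega>. disc_return \<gamma> rew H M \<omega> 0)"
  proof (rule integrable_const_bound[of _ 1, OF _ meas], rule AE_I2)
    show "norm (disc_return \<gamma> rew H M \<omega> 0) \<le> 1" for \<omega> :: "('a, 'o, 'r) outcome"
      using zvals_bounds[OF zv[of H \<omega> 0]] by simp
  qed
  have intR: "integrable ?P (\<lambda>\<omega>. ret \<gamma> rew \<omega> 0)"
    by (simp add: continue_from_act_def integrable_ret)
  \<comment> \<open>The discretized return is a simple function: exactly one indicator is 1.
    Integrating it gives \<open>q\<close>.\<close>
  have "disc_return \<gamma> rew H M \<omega> 0 = (\<Sum>z\<in>zvals M. z * indicator {\<omega>. disc_return \<gamma> rew H M \<omega> 0 = z} \<omega>)"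
    for \<omega> :: "('a, 'o, 'r) outcome"
    using zv[of H \<omega> 0] sum.remove[OF finite_zvals zv[of H \<omega> 0], of "\<lambda>z. z * indicator {\<omega>. disc_return \<gamma> rew H M \<omega> 0 = z} \<omega>"]
    by simp
  then have "(\<integral>\<omega>. disc_return \<gamma> rew H M \<omega> 0 \<partial>?P) =
      (\<integral>\<omega>. (\<Sum>z\<in>zvals M. z * indicator {\<omega>. disc_return \<gamma> rew H M \<omega> 0 = z} \<omega>) \<partial>?P)"
    by simp
  also have "\<dots> = q"
    unfolding q_def
    by (subst Bochner_Integration.integral_sum) (auto simp: sets emeasure_eq_measure)
  finally have q: "(\<integral>\<omega>. disc_return \<gamma> rew H M \<omega> 0 \<partial>?P) = q" .
  show "q \<le> backup \<gamma> rew \<nu> (policy_value \<gamma> rew \<pi> \<nu>) h a"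
    unfolding q[symmetric] integral_ret_continue_from_act[symmetric]
    by (intro integral_mono int intR disc_return_bounds M)
  have "(\<integral>\<omega>. ret \<gamma> rew \<omega> 0 \<partial>?P) \<le> (\<integral>\<omega>. disc_return \<gamma> rew H M \<omega> 0 + (1 / real M + \<gamma> ^ H) \<partial>?P)"
    by (intro integral_mono intR disc_return_bounds M Bochner_Integration.integrable_add int integrable_const)
  also have "\<dots> = q + (1 / real M + \<gamma> ^ H)"
    using int q prob_space by (subst Bochner_Integration.integral_add) auto
  finally show "backup \<gamma> rew \<nu> (policy_value \<gamma> rew \<pi> \<nu>) h a \<le> q + (1 / real M + \<gamma> ^ H)"
    unfolding integral_ret_continue_from_act .
qed

end

section \<open>Negligible functions of histories\<close>

definition hist_mean ::
  "('a::finite, 'o::finite, 'r::finite) policy \<Rightarrow> ('a, 'o, 'r) env \<Rightarrow> nat \<Rightarrow> (('a, 'o, 'r) history \<Rightarrow> real) \<Rightarrow> real" where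
  "hist_mean \<pi> \<nu> t f = (\<Sum>h | length h = t. hist_prob \<pi> \<nu> h * f h)"

lemma sum_length_append:
  fixes f :: "'b::finite list \<Rightarrow> 'c::comm_monoid_add"
  shows "(\<Sum>h | length h = m + n. f h) = (\<Sum>h | length h = m. \<Sum>g | length g = n. f (h @ g))"
proof -
  have "(\<Sum>h | length h = m. \<Sum>g | length g = n. f (h @ g)) =
      (\<Sum>(h, g)\<in>{h. length h = m} \<times> {g. length g = n}. f (h @ g))"
    by (rule sum.cartesian_product)
  also have "\<dots> = (\<Sum>h | length h = m + n. f h)"
    by (rule sum.reindex_bij_witness[of _ "\<lambda>h. (take m h, drop m h)" "\<lambda>(h, g). h @ g"]) auto
  finally show ?thesis ..
qed

lemma sum_length_Suc_0:
  fixes f :: "'b::finite list \<Rightarrow> 'c::comm_monoid_add"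
  shows "(\<Sum>h | length h = Suc 0. f h) = (\<Sum>b\<in>UNIV. f [b])"
  by (rule sum.reindex_bij_witness[of _ "\<lambda>b. [b]" hd]) (auto simp: length_Suc_conv)

text \<open>Tower property: condition on the first \<open>m\<close> blocks, then average over
  \<open>n\<close> more.\<close>

lemma hist_mean_append:
  "hist_mean \<pi> \<nu> (m + n) f =
    (\<Sum>h | length h = m. hist_prob \<pi> \<nu> h *
      hist_mean (\<lambda>g. \<pi> (h @ g)) (\<lambda>g. \<nu> (h @ g)) n (\<lambda>g. f (h @ g)))"
  unfolding hist_mean_def sum_length_append
  by (intro sum.cong refl) (simp add: hist_prob_append sum_distrib_left mult.assoc)

lemma hist_mean_Suc_0:
  "hist_mean \<pi> \<nu> (Suc 0) f = (\<Sum>a\<in>UNIV. pmf (\<pi> []) a * (\<Sum>e\<in>UNIV. pmf (\<nu> [] a) e * f [(a, e)]))"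
proof -
  have "hist_mean \<pi> \<nu> (Suc 0) f = (\<Sum>(a, e)\<in>UNIV \<times> UNIV. pmf (\<pi> []) a * (pmf (\<nu> [] a) e * f [(a, e)]))"
    unfolding hist_mean_def sum_length_Suc_0 using hist_prob_snoc[of \<pi> \<nu> "[]"]
    by (intro sum.cong) (auto simp: pmf_step_pmf)
  then show ?thesis
    unfolding sum.cartesian_product[symmetric] sum_distrib_left .
qed

lemma hist_mean_add: "hist_mean \<pi> \<nu> t (\<lambda>h. f h + g h) = hist_mean \<pi> \<nu> t f + hist_mean \<pi> \<nu> t g"
  by (simp add: hist_mean_def sum.distrib distrib_left)

lemma hist_mean_cmult: "hist_mean \<pi> \<nu> t (\<lambda>h. c * f h) = c * hist_mean \<pi> \<nu> t f"
  by (simp add: hist_mean_def sum_distrib_left mult.left_commute)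

lemma hist_mean_mono:
  assumes "\<And>h. length h = t \<Longrightarrow> f h \<le> g h"
  shows "hist_mean \<pi> \<nu> t f \<le> hist_mean \<pi> \<nu> t g"
  unfolding hist_mean_def using assms by (intro sum_mono mult_left_mono hist_prob_nonneg) auto

lemma hist_mean_nonneg:
  assumes "\<And>h. 0 \<le> f h"
  shows "0 \<le> hist_mean \<pi> \<nu> t f"
  unfolding hist_mean_def using assms by (intro sum_nonneg mult_nonneg_nonneg hist_prob_nonneg)

text \<open>This is negligibility. Nonnegativity belongs to it so that summable means force almost
  sure convergence of the series along the outcome.\<close>

definition summable_mean ::
  "('a::finite, 'o::finite, 'r::finite) policy \<Rightarrow> ('a, 'o, 'r) env \<Rightarrow> (('a, 'o, 'r) history \<Rightarrow> real) \<Rightarrow> bool" where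
  "summable_mean \<pi> \<nu> g \<longleftrightarrow> (\<forall>h. 0 \<le> g h) \<and> summable (\<lambda>t. hist_mean \<pi> \<nu> t g)"

lemma summable_mean_nonneg: "summable_mean \<pi> \<nu> g \<Longrightarrow> 0 \<le> g h"
  by (simp add: summable_mean_def)

lemma summable_mean_zero: "summable_mean \<pi> \<nu> (\<lambda>_. 0)"
  by (simp add: summable_mean_def hist_mean_def)

lemma summable_mean_add:
  "summable_mean \<pi> \<nu> f \<Longrightarrow> summable_mean \<pi> \<nu> g \<Longrightarrow> summable_mean \<pi> \<nu> (\<lambda>h. f h + g h)"
  by (auto simp: summable_mean_def hist_mean_add intro: summable_add)

lemma summable_mean_cmult: "0 \<le> c \<Longrightarrow> summable_mean \<pi> \<nu> f \<Longrightarrow> summable_mean \<pi> \<nu> (\<lambda>h. c * f h)"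
  by (auto simp: summable_mean_def hist_mean_cmult intro: summable_mult)

text \<open>Borel-Cantelli style: by monotone convergence the series of values along an outcome has
  finite expectation, so it converges almost surely and its terms tend to 0.\<close>

lemma summable_mean_AE_tendsto_0:
  fixes \<pi> :: "('a::finite, 'o::finite, 'r::finite) policy"
  assumes g: "summable_mean \<pi> \<nu> g"
  shows "AE \<omega> in interaction \<pi> \<nu>. (\<lambda>t. g (hist_before \<omega> t)) \<longlonglongrightarrow> 0"
proof -
  note [measurable] = measurable_prefix[where 'b="('a, 'o, 'r) block"]
  have g0: "0 \<le> g h" for h using g by (rule summable_mean_nonneg)
  have meas: "(\<lambda>\<omega>. ennreal (g (map \<omega> [0..<t]))) \<in> borel_measurable (interaction \<pi> \<nu>)" for t
    unfolding measurable_cong_sets[OF sets_interaction refl] by measurable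
  have "(\<integral>\<^sup>+\<omega>. (\<Sum>t. ennreal (g (map \<omega> [0..<t]))) \<partial>interaction \<pi> \<nu>) =
      (\<Sum>t. ennreal (hist_mean \<pi> \<nu> t g))"
    by (subst nn_integral_suminf[OF meas]) (simp add: nn_integral_prefix g0 hist_mean_def)
  also have "\<dots> = ennreal (\<Sum>t. hist_mean \<pi> \<nu> t g)"
    using g by (intro suminf_ennreal2 hist_mean_nonneg g0) (simp add: summable_mean_def)
  finally have "(\<integral>\<^sup>+\<omega>. (\<Sum>t. ennreal (g (map \<omega> [0..<t]))) \<partial>interaction \<pi> \<nu>) \<noteq> \<infinity>"
    by simp
  then have "AE \<omega> in interaction \<pi> \<nu>. (\<Sum>t. ennreal (g (map \<omega> [0..<t]))) \<noteq> \<infinity>"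
    by (intro nn_integral_PInf_AE borel_measurable_suminf_order meas)
  then show ?thesis
  proof eventually_elim
    case (elim \<omega>)
    then have "summable (\<lambda>t. g (map \<omega> [0..<t]))"
      using g0 by (intro summable_suminf_not_top) auto
    \<comment> \<open>The prefix of length \<open>t\<close> is the history before time
      \<open>Suc t\<close>.\<close>
    then have "(\<lambda>t. g (hist_before \<omega> (Suc t))) \<longlonglongrightarrow> 0"
      using summable_LIMSEQ_zero by (simp add: hist_before_def)
    then show ?case by (rule LIMSEQ_imp_Suc)
  qed
qed

text \<open>Actions are summed without weights, so for nonnegative \<open>f\<close> this dominates
  the expectation over percepts after any single action, including one the policy rarely
  takes.\<close>

definition next_sum :: "('a::finite, 'o::finite, 'r::finite) env \<Rightarrow> (('a, 'o, 'r) history \<Rightarrow> real) \<Rightarrow> ('a, 'o, 'r) history \<Rightarrow> real" where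
  "next_sum \<nu> f h = (\<Sum>a\<in>UNIV. \<Sum>e\<in>UNIV. pmf (\<nu> h a) e * f (h @ [(a, e)]))"

lemma expectation_le_next_sum:
  assumes "\<And>h. 0 \<le> f h"
  shows "(\<Sum>e\<in>UNIV. pmf (\<nu> h a) e * f (h @ [(a, e)])) \<le> next_sum \<nu> f h"
  unfolding next_sum_def using assms
  by (intro member_le_sum[of a UNIV "\<lambda>a. \<Sum>e\<in>UNIV. pmf (\<nu> h a) e * f (h @ [(a, e)])"] sum_nonneg) auto

lemma next_sum_nonneg: "(\<And>h. 0 \<le> f h) \<Longrightarrow> 0 \<le> next_sum \<nu> f h"
  unfolding next_sum_def by (intro sum_nonneg) auto

section \<open>Propagation of negligible errors under exploration\<close>

locale exploring =
  fixes \<pi> :: "('a::finite, 'o::finite, 'r::finite) policy" and \<nu> :: "('a, 'o, 'r) env" and p :: real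
  assumes p_pos: "0 < p" and p_le: "\<And>h a. p \<le> pmf (\<pi> h) a"
begin

text \<open>Exploration makes the worst action at most \<open>1 / p\<close> times as bad as the average one.\<close>

lemma sum_le_policy_mean:
  assumes "\<And>a. 0 \<le> f a"
  shows "(\<Sum>a\<in>UNIV. f a) \<le> (1 / p) * (\<Sum>a\<in>UNIV. pmf (\<pi> h) a * f a)"
proof -
  have "p * (\<Sum>a\<in>UNIV. f a) \<le> (\<Sum>a\<in>UNIV. pmf (\<pi> h) a * f a)"
    unfolding sum_distrib_left using assms p_le by (intro sum_mono mult_right_mono) auto
  then show ?thesis using p_pos by (simp add: field_simps)
qed

text \<open>Each action has policy weight at least \<open>p\<close>, so the unweighted sum costs a
  factor \<open>1 / p\<close> over the mean of \<open>g\<close> one step later.\<close>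

lemma summable_mean_next_sum:
  assumes g: "summable_mean \<pi> \<nu> g"
  shows "summable_mean \<pi> \<nu> (next_sum \<nu> g)"
proof -
  have g0: "0 \<le> g h" for h using g by (rule summable_mean_nonneg)
  have ng0: "0 \<le> next_sum \<nu> g h" for h by (rule next_sum_nonneg) (rule g0)
  have "hist_mean \<pi> \<nu> t (next_sum \<nu> g) \<le> (1 / p) * hist_mean \<pi> \<nu> (Suc t) g" for t
  proof -
    have "next_sum \<nu> g h \<le>
        (1 / p) * hist_mean (\<lambda>h'. \<pi> (h @ h')) (\<lambda>h'. \<nu> (h @ h')) (Suc 0) (\<lambda>h'. g (h @ h'))" for h
      unfolding next_sum_def hist_mean_Suc_0 append_Nil2
      by (intro sum_le_policy_mean sum_nonneg mult_nonneg_nonneg g0 pmf_nonneg)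
    then have "hist_mean \<pi> \<nu> t (next_sum \<nu> g) \<le> hist_mean \<pi> \<nu> t
        (\<lambda>h. (1 / p) * hist_mean (\<lambda>h'. \<pi> (h @ h')) (\<lambda>h'. \<nu> (h @ h')) (Suc 0) (\<lambda>h'. g (h @ h')))"
      by (rule hist_mean_mono)
    also have "\<dots> = (1 / p) * hist_mean \<pi> \<nu> (t + Suc 0) g"
      unfolding hist_mean_cmult hist_mean_append by (simp add: hist_mean_def[of \<pi> \<nu> t])
    finally show ?thesis by simp
  qed
  then have "norm (hist_mean \<pi> \<nu> t (next_sum \<nu> g)) \<le> (1 / p) * hist_mean \<pi> \<nu> (Suc t) g" for t
    using hist_mean_nonneg[of "next_sum \<nu> g" \<pi> \<nu> t, OF ng0] by simp
  moreover have "summable (\<lambda>t. (1 / p) * hist_mean \<pi> \<nu> (Suc t) g)"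
    using g summable_Suc_iff[of "\<lambda>t. hist_mean \<pi> \<nu> t g"]
    by (intro summable_mult) (simp add: summable_mean_def)
  ultimately have "summable (\<lambda>t. hist_mean \<pi> \<nu> t (next_sum \<nu> g))"
    by (rule summable_comparison_test'[rotated])
  then show ?thesis using ng0 by (simp add: summable_mean_def)
qed

text \<open>Unroll the recursion \<open>K\<close> times: the constants add up to at most
  \<open>c / (1 - \<gamma>)\<close>, the remaining \<open>U\<close> contributes
  \<open>\<gamma> ^ K\<close>, and the errors stay negligible under \<open>next_sum\<close>. Since
  each \<open>next_sum\<close> may cost a factor \<open>1 / p\<close>, the unrolling stops at a
  finite \<open>K\<close>, and \<rho> pays for the remainder. The action in \<open>rec\<close> may
  depend on \<open>h\<close> in any way.\<close>

lemma discounted_recursion_bound: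
  fixes U G :: "('a, 'o, 'r) history \<Rightarrow> real"
  assumes \<gamma>: "0 < \<gamma>" "\<gamma> < 1" and U: "\<And>h. U h \<le> 1" and c: "0 \<le> c" and G: "summable_mean \<pi> \<nu> G"
    and rec: "\<And>h. \<exists>a. U h \<le> c + G h + \<gamma> * (\<Sum>e\<in>UNIV. pmf (\<nu> h a) e * U (h @ [(a, e)]))"
    and \<rho>: "0 < \<rho>"
  shows "\<exists>g. summable_mean \<pi> \<nu> g \<and> (\<forall>h. U h \<le> c / (1 - \<gamma>) + \<rho> + g h)"
proof -
  have *: "\<exists>g. summable_mean \<pi> \<nu> g \<and> (\<forall>h. U h \<le> c / (1 - \<gamma>) + \<gamma> ^ K + g h)" for K
  proof (induction K)
    case 0
    have "0 \<le> c / (1 - \<gamma>)" using \<gamma> c by simp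
    then have "U h \<le> c / (1 - \<gamma>) + \<gamma> ^ 0 + 0" for h using U[of h] by simp
    then show ?case using summable_mean_zero by blast
  next
    case (Suc K)
    then obtain g where g: "summable_mean \<pi> \<nu> g" "\<And>h. U h \<le> c / (1 - \<gamma>) + \<gamma> ^ K + g h" by auto
    note g0 = summable_mean_nonneg[OF g(1)]
    have ng0: "0 \<le> next_sum \<nu> g h" for h by (rule next_sum_nonneg) (rule g0)
    have "U h \<le> c / (1 - \<gamma>) + \<gamma> ^ Suc K + (G h + next_sum \<nu> g h)" for h
    proof -
      obtain a where a: "U h \<le> c + G h + \<gamma> * (\<Sum>e\<in>UNIV. pmf (\<nu> h a) e * U (h @ [(a, e)]))"
        using rec by blast
      have "(\<Sum>e\<in>UNIV. pmf (\<nu> h a) e * U (h @ [(a, e)])) \<le>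
          (\<Sum>e\<in>UNIV. pmf (\<nu> h a) e * (c / (1 - \<gamma>) + \<gamma> ^ K + g (h @ [(a, e)])))"
        by (intro sum_mono mult_left_mono g) auto
      also have "\<dots> = (\<Sum>e\<in>UNIV. pmf (\<nu> h a) e) * (c / (1 - \<gamma>) + \<gamma> ^ K) +
          (\<Sum>e\<in>UNIV. pmf (\<nu> h a) e * g (h @ [(a, e)]))"
        by (simp only: distrib_left[of "pmf _ _"] sum.distrib sum_distrib_right)
      also have "\<dots> \<le> c / (1 - \<gamma>) + \<gamma> ^ K + next_sum \<nu> g h"
        using expectation_le_next_sum[OF g0, of \<nu> h a] by (simp add: sum_pmf_UNIV)
      finally have "\<gamma> * (\<Sum>e\<in>UNIV. pmf (\<nu> h a) e * U (h @ [(a, e)])) \<le>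
          \<gamma> * (c / (1 - \<gamma>) + \<gamma> ^ K + next_sum \<nu> g h)"
        using \<gamma> by (intro mult_left_mono) auto
      moreover have "\<gamma> * next_sum \<nu> g h \<le> next_sum \<nu> g h"
        using \<gamma> ng0 by (intro mult_left_le_one_le) auto
      \<comment> \<open>\<open>c / (1 - \<gamma>)\<close> is the fixed point of the map that sends
        \<open>x\<close> to \<open>c + \<gamma> * x\<close>.\<close>
      moreover have "c + \<gamma> * (c / (1 - \<gamma>)) = c / (1 - \<gamma>)" using \<gamma> by (simp add: field_simps)
      ultimately show ?thesis using a by (simp add: distrib_left)
    qed
    then show ?case using summable_mean_add[OF G summable_mean_next_sum[OF g(1)]] by blast
  qed
  obtain K where "\<gamma> ^ K < \<rho>" using real_arch_pow_inv[OF \<rho>] \<gamma> by auto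
  then show ?thesis using *[of K] by (smt (verit))
qed

end

section \<open>Prediction errors of dominating mixtures\<close>

text \<open>With \<open>u\<close> and \<open>v\<close> the square roots, the logarithm is bounded
  through the squared Hellinger term \<open>(u - v)\<^sup>2\<close>. The linear part
  \<open>x - y\<close> is kept because it cancels on summing over two distributions.\<close>

lemma kl_term_ge:
  fixes x y :: real
  assumes "0 \<le> x" "x \<le> 1" "0 \<le> y" "y \<le> 1" "0 < x \<Longrightarrow> 0 < y"
  shows "x - y + (x - y)\<^sup>2 / 4 \<le> x * ln (x / y)"
proof -
  define u v where "u = sqrt x" and "v = sqrt y"
  have uv: "0 \<le> u" "u \<le> 1" "0 \<le> v" "v \<le> 1" "x = u\<^sup>2" "y = v\<^sup>2"
    using assms by (auto simp: u_def v_def)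
  \<comment> \<open>Since \<open>x - y = (u - v) * (u + v)\<close> and \<open>u + v \<le> 2\<close>,
    the Hellinger term dominates a quarter of the squared difference.\<close>
  have "(u + v)\<^sup>2 \<le> 2\<^sup>2" using uv by (intro power_mono) auto
  then have "(u - v)\<^sup>2 * (u + v)\<^sup>2 \<le> (u - v)\<^sup>2 * 4" by (intro mult_left_mono) auto
  moreover have "(u - v)\<^sup>2 * (u + v)\<^sup>2 = (x - y)\<^sup>2"
    unfolding uv by (simp add: power2_eq_square algebra_simps)
  ultimately have sq: "(x - y)\<^sup>2 / 4 \<le> (u - v)\<^sup>2" by simp
  have "x - y + (u - v)\<^sup>2 \<le> x * ln (x / y)"
  proof (cases "x = 0")
    case True
    then show ?thesis using uv by simp
  next
    case False
    then have "0 < x" "0 < y" using assms by auto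
    then have pos: "0 < u" "0 < v" by (simp_all add: u_def v_def)
    \<comment> \<open>Applying the tangent bound to the ratio of roots, rather than to
      \<open>y / x\<close>, leaves the square \<open>(u - v)\<^sup>2\<close> as a surplus.\<close>
    have "ln (v / u) \<le> v / u - 1" using pos by (intro ln_le_minus_one) auto
    moreover have "ln (x / y) = - 2 * ln (v / u)"
      using pos unfolding uv by (simp add: ln_div ln_realpow)
    ultimately have "x * (2 * (1 - v / u)) \<le> x * ln (x / y)"
      using assms by (intro mult_left_mono) auto
    moreover have "x * (2 * (1 - v / u)) = x - y + (u - v)\<^sup>2"
      using pos unfolding uv by (simp add: power2_eq_square field_simps)
    ultimately show ?thesis by simp
  qed
  then show ?thesis using sq by simp
qed

lemma kl_ge:
  fixes \<rho> \<sigma> :: "'x \<Rightarrow> real"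
  assumes "finite X" and \<rho>: "\<And>x. x \<in> X \<Longrightarrow> 0 \<le> \<rho> x" "sum \<rho> X = 1"
    and \<sigma>: "\<And>x. x \<in> X \<Longrightarrow> 0 \<le> \<sigma> x" "sum \<sigma> X = 1"
    and ac: "\<And>x. x \<in> X \<Longrightarrow> 0 < \<rho> x \<Longrightarrow> 0 < \<sigma> x"
  shows "(\<Sum>x\<in>X. (\<rho> x - \<sigma> x)\<^sup>2) / 4 \<le> (\<Sum>x\<in>X. \<rho> x * ln (\<rho> x / \<sigma> x))"
proof -
  have le1: "\<rho> x \<le> 1 \<and> \<sigma> x \<le> 1" if "x \<in> X" for x
    using member_le_sum[OF that, of \<rho>] member_le_sum[OF that, of \<sigma>] assms by auto
  have "(\<Sum>x\<in>X. \<rho> x - \<sigma> x + (\<rho> x - \<sigma> x)\<^sup>2 / 4) \<le> (\<Sum>x\<in>X. \<rho> x * ln (\<rho> x / \<sigma> x))"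
    using le1 by (intro sum_mono kl_term_ge \<rho> \<sigma> ac) auto
  then show ?thesis
    using \<rho> \<sigma> by (simp add: sum.distrib sum_subtractf sum_divide_distrib)
qed

text \<open>The first \<open>n\<close> terms lie within the first \<open>n\<close> groups of
  \<open>N\<close> consecutive terms; these are regrouped by residue. It reduces all times to single
  phases.\<close>

lemma summable_residues:
  fixes g :: "nat \<Rightarrow> real"
  assumes g0: "\<And>t. 0 \<le> g t" and "0 < N" and s: "\<And>m. m < N \<Longrightarrow> summable (\<lambda>k. g (m + k * N))"
  shows "summable g"
proof (rule summableI_nonneg_bounded[OF g0])
  fix n
  have "(\<Sum>t<n. g t) \<le> (\<Sum>t<n * N. g t)"
    using g0 \<open>0 < N\<close> by (intro sum_mono2) auto
  also have "\<dots> = (\<Sum>k<n. \<Sum>t\<in>{k * N..<k * N + N}. g t)"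
    by (rule sum.nat_group[symmetric])
  also have "\<dots> = (\<Sum>k<n. \<Sum>m<N. g (m + k * N))"
    using sum.shift_bounds_nat_ivl[of g 0 _ N] by (simp only: add_0 lessThan_atLeast0 add.commute[of N])
  also have "\<dots> = (\<Sum>m<N. \<Sum>k<n. g (m + k * N))"
    by (rule sum.swap)
  also have "\<dots> \<le> (\<Sum>m<N. \<Sum>k. g (m + k * N))"
    using g0 s by (intro sum_mono sum_le_suminf) auto
  finally show "(\<Sum>t<n. g t) \<le> (\<Sum>m<N. \<Sum>k. g (m + k * N))" .
qed

context exploring
begin

text \<open>
  The expected log-likelihood ratio of \<open>\<rho>\<close> to \<open>\<sigma>\<close> grows at each block by a conditional
  Kullback-Leibler divergence, and dominance keeps it below \<open>ln (1 / w)\<close>.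
\<close>

lemma summable_prediction_error:
  fixes m N :: nat and X :: "'x set" and x :: "('a, 'o, 'r) history \<Rightarrow> 'x"
    and \<rho> \<sigma> :: "('a, 'o, 'r) history \<Rightarrow> 'a \<Rightarrow> 'x \<Rightarrow> real" and L\<rho> L\<sigma> :: "('a, 'o, 'r) history \<Rightarrow> real"
  defines "boundary \<equiv> \<lambda>h :: ('a, 'o, 'r) history. \<exists>k. length h = m + k * N"
  assumes "finite X" and xX: "\<And>c. length c = N \<Longrightarrow> x c \<in> X"
    and \<rho>: "\<And>h a y. boundary h \<Longrightarrow> y \<in> X \<Longrightarrow> 0 \<le> \<rho> h a y" "\<And>h a. boundary h \<Longrightarrow> sum (\<rho> h a) X = 1"
    and \<sigma>: "\<And>h a y. boundary h \<Longrightarrow> y \<in> X \<Longrightarrow> 0 \<le> \<sigma> h a y" "\<And>h a. boundary h \<Longrightarrow> sum (\<sigma> h a) X = 1"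
    and base: "\<And>h. length h = m \<Longrightarrow> L\<rho> h = 1 \<and> L\<sigma> h = 1"
    and step: "\<And>h c. boundary h \<Longrightarrow> length c = N \<Longrightarrow> L\<rho> (h @ c) = L\<rho> h * \<rho> h (fst (hd c)) (x c)"
      "\<And>h c. boundary h \<Longrightarrow> length c = N \<Longrightarrow> L\<sigma> (h @ c) = L\<sigma> h * \<sigma> h (fst (hd c)) (x c)"
    and w: "0 < w" and dom: "\<And>h. boundary h \<Longrightarrow> w * L\<rho> h \<le> L\<sigma> h"
    and law: "\<And>h F. boundary h \<Longrightarrow>
      hist_mean (\<lambda>g. \<pi> (h @ g)) (\<lambda>g. \<nu> (h @ g)) N (\<lambda>c. F (fst (hd c)) (x c)) =
      (\<Sum>a\<in>UNIV. pmf (\<pi> h) a * (\<Sum>y\<in>X. \<rho> h a y * F a y))"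
  shows "summable (\<lambda>k. hist_mean \<pi> \<nu> (m + k * N) (\<lambda>h. \<Sum>a\<in>UNIV. \<Sum>y\<in>X. (\<rho> h a y - \<sigma> h a y)\<^sup>2))"
proof -
  define hp where "hp h = hist_prob (\<lambda>g. \<pi> (h @ g)) (\<lambda>g. \<nu> (h @ g))" for h
  define E where "E h = (\<Sum>a\<in>UNIV. \<Sum>y\<in>X. (\<rho> h a y - \<sigma> h a y)\<^sup>2)" for h
  define KL where "KL k = hist_mean \<pi> \<nu> (m + k * N) (\<lambda>h. ln (L\<rho> h / L\<sigma> h))" for k
  have hp_append: "hist_prob \<pi> \<nu> (h @ c) = hist_prob \<pi> \<nu> h * hp h c" for h c
    unfolding hp_def by (rule hist_prob_append)
  have hp0: "0 \<le> hp h c" for h c unfolding hp_def by (rule hist_prob_nonneg)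
  \<comment> \<open>Testing \<open>law\<close> on the indicator of a pair gives the joint
    probability of the first action and the observed symbol.\<close>
  have ind: "(\<Sum>c | length c = N \<and> fst (hd c) = a \<and> x c = y. hp h c) = pmf (\<pi> h) a * \<rho> h a y"
    if h: "boundary h" and y: "y \<in> X" for h a y
  proof -
    let ?F = "\<lambda>b z. if b = a \<and> z = y then 1 else 0 :: real"
    have "(\<Sum>c | length c = N \<and> fst (hd c) = a \<and> x c = y. hp h c) =
        (\<Sum>c | length c = N. hp h c * ?F (fst (hd c)) (x c))"
      by (intro sum.mono_neutral_cong_left finite_length_eq) auto
    also have "\<dots> = (\<Sum>b\<in>UNIV. pmf (\<pi> h) b * (\<Sum>z\<in>X. \<rho> h b z * ?F b z))"
      using law[OF h, of ?F] by (simp add: hist_mean_def hp_def)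
    also have "\<dots> = (\<Sum>b\<in>UNIV. if b = a then pmf (\<pi> h) b * \<rho> h b y else 0)"
    proof (intro sum.cong refl)
      fix b
      have "(\<Sum>z\<in>X. \<rho> h b z * ?F b z) = (\<Sum>z\<in>X. if z = y then (if b = a then \<rho> h b z else 0) else 0)"
        by (intro sum.cong) auto
      then show "pmf (\<pi> h) b * (\<Sum>z\<in>X. \<rho> h b z * ?F b z) = (if b = a then pmf (\<pi> h) b * \<rho> h b y else 0)"
        using y \<open>finite X\<close> by simp
    qed
    also have "\<dots> = pmf (\<pi> h) a * \<rho> h a y" by simp
    finally show ?thesis .
  qed
  have fin: "finite {c :: ('a, 'o, 'r) history. length c = N \<and> fst (hd c) = a \<and> x c = y}" for a y
    by (rule finite_subset[OF _ finite_length_eq[of N]]) auto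
  \<comment> \<open>If \<open>\<rho>\<close> vanished, all continuations with the same action and
    symbol would have total probability 0, including \<open>c\<close>.\<close>
  have \<rho>_pos: "0 < \<rho> h (fst (hd c)) (x c)" if h: "boundary h" and c: "length c = N" "0 < hp h c" for h c
  proof (rule ccontr)
    let ?S = "{c'. length c' = N \<and> fst (hd c') = fst (hd c) \<and> x c' = x c}"
    assume "\<not> 0 < \<rho> h (fst (hd c)) (x c)"
    then have "(\<Sum>c'\<in>?S. hp h c') = 0"
      using ind[OF h xX[OF c(1)], of "fst (hd c)"] \<rho>(1)[OF h xX[OF c(1)], of "fst (hd c)"] by simp
    then show False using c hp0 sum_nonneg_0[OF fin[of "fst (hd c)" "x c"], of "hp h" c] by simp
  qed
  \<comment> \<open>Induction over blocks, peeling off the last \<open>N\<close> steps. Positivity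
    then passes to \<open>L\<sigma>\<close> by dominance.\<close>
  have L\<rho>_pos: "0 < L\<rho> h" if "length h = m + k * N" "0 < hist_prob \<pi> \<nu> h" for k h
    using that
  proof (induction k arbitrary: h)
    case 0
    then show ?case using base by simp
  next
    case (Suc k)
    define h' c where "h' = take (m + k * N) h" and "c = drop (m + k * N) h"
    have h: "h = h' @ c" "length h' = m + k * N" "length c = N" using Suc.prems by (auto simp: h'_def c_def)
    then have boundary: "boundary h'" by (auto simp: boundary_def)
    have "0 < hist_prob \<pi> \<nu> h'" "0 < hp h' c"
      using Suc.prems(2) hist_prob_nonneg[of \<pi> \<nu> h'] hp0[of h' c] unfolding h(1) hp_append
      by (simp_all add: zero_less_mult_iff)
    then show ?case
      using Suc.IH[OF h(2)] \<rho>_pos[OF boundary h(3)] step(1)[OF boundary h(3)] h(1) by simp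
  qed
  have L\<sigma>_pos: "0 < L\<sigma> h" if "boundary h" "0 < hist_prob \<pi> \<nu> h" for h
    using that dom[OF that(1)] L\<rho>_pos[of h] w by (auto simp: boundary_def intro: less_le_trans[OF mult_pos_pos])
  have \<sigma>_pos: "0 < \<sigma> h (fst (hd c)) (x c)"
    if h: "boundary h" "0 < hist_prob \<pi> \<nu> h" and c: "length c = N" "0 < hp h c" for h c
  proof -
    have "boundary (h @ c)" using h c unfolding boundary_def by (auto intro: exI[of _ "Suc _"])
    then have "0 < L\<sigma> (h @ c)" using h c by (intro L\<sigma>_pos) (auto simp: hp_append)
    then show ?thesis
      using step(2)[OF h(1) c(1)] L\<sigma>_pos[OF h] by (simp add: zero_less_mult_iff)
  qed
  \<comment> \<open>Absolute continuity after a reachable history: every action is explored, so some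
    continuation of positive probability shows the pair \<open>(a, y)\<close>, and
    \<open>\<sigma>_pos\<close> applies to it.\<close>
  have ac: "0 < \<sigma> h a y" if h: "boundary h" "0 < hist_prob \<pi> \<nu> h" and y: "y \<in> X" "0 < \<rho> h a y" for h a y
  proof -
    have "0 < pmf (\<pi> h) a" using p_pos p_le[of h a] by simp
    then have "(\<Sum>c | length c = N \<and> fst (hd c) = a \<and> x c = y. hp h c) \<noteq> 0"
      using ind[OF h(1) y(1), of a] y by simp
    then obtain c where c: "length c = N" "fst (hd c) = a" "x c = y" "hp h c \<noteq> 0"
      by (auto elim: sum.not_neutral_contains_not_neutral)
    then show ?thesis using \<sigma>_pos[OF h, of c] hp0[of h c] by auto
  qed
  \<comment> \<open>Chain rule for the divergence: the increment is a mean of conditional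
    divergences, bounded below by squared errors via \<open>kl_ge\<close>, with each action weight
    at least \<open>p\<close>.\<close>
  have KL_step: "KL k + p / 4 * hist_mean \<pi> \<nu> (m + k * N) E \<le> KL (Suc k)" for k
  proof -
    \<comment> \<open>Histories of probability 0 drop out through their weight; on the others both
      likelihoods are positive and the logarithms can be split.\<close>
    have "hist_prob \<pi> \<nu> h * (ln (L\<rho> h / L\<sigma> h) + p / 4 * E h) \<le>
        hist_prob \<pi> \<nu> h * (\<Sum>c | length c = N. hp h c * ln (L\<rho> (h @ c) / L\<sigma> (h @ c)))"
      if len: "length h = m + k * N" for h
    proof (cases "hist_prob \<pi> \<nu> h = 0")
      case False
      have h: "boundary h" using len by (auto simp: boundary_def)
      have hpos: "0 < hist_prob \<pi> \<nu> h" using False hist_prob_nonneg[of \<pi> \<nu> h] by simp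
      let ?r = "\<lambda>a y. ln (\<rho> h a y / \<sigma> h a y)"
      have "p / 4 * E h = (\<Sum>a\<in>UNIV. p * ((\<Sum>y\<in>X. (\<rho> h a y - \<sigma> h a y)\<^sup>2) / 4))"
        by (simp add: E_def sum_distrib_left sum_divide_distrib)
      also have "\<dots> \<le> (\<Sum>a\<in>UNIV. pmf (\<pi> h) a * ((\<Sum>y\<in>X. (\<rho> h a y - \<sigma> h a y)\<^sup>2) / 4))"
        using p_le by (intro sum_mono mult_right_mono divide_nonneg_nonneg sum_nonneg) auto
      also have "\<dots> \<le> (\<Sum>a\<in>UNIV. pmf (\<pi> h) a * (\<Sum>y\<in>X. \<rho> h a y * ?r a y))"
        using \<open>finite X\<close> by (intro sum_mono mult_left_mono kl_ge \<rho>[OF h] \<sigma>[OF h] ac[OF h hpos]) auto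
      also have "\<dots> = (\<Sum>c | length c = N. hp h c * ?r (fst (hd c)) (x c))"
        using law[OF h, of ?r] by (simp add: hist_mean_def hp_def)
      finally have 1: "p / 4 * E h \<le> (\<Sum>c | length c = N. hp h c * ?r (fst (hd c)) (x c))" .
      \<comment> \<open>On continuations of positive probability the log-ratio is the old one plus
        that of the new symbol.\<close>
      have "(\<Sum>c | length c = N. hp h c * ln (L\<rho> (h @ c) / L\<sigma> (h @ c))) =
          (\<Sum>c | length c = N. hp h c * (ln (L\<rho> h / L\<sigma> h) + ?r (fst (hd c)) (x c)))"
      proof (intro sum.cong refl)
        fix c :: "('a, 'o, 'r) history" assume "c \<in> {c. length c = N}"
        then have c: "length c = N" by simp
        show "hp h c * ln (L\<rho> (h @ c) / L\<sigma> (h @ c)) = hp h c * (ln (L\<rho> h / L\<sigma> h) + ?r (fst (hd c)) (x c))"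
        proof (cases "hp h c = 0")
          case False
          then have "0 < hp h c" using hp0[of h c] by simp
          then show ?thesis
            using L\<rho>_pos[OF len hpos] L\<sigma>_pos[OF h hpos] \<rho>_pos[OF h c] \<sigma>_pos[OF h hpos c]
            by (simp add: step[OF h c] ln_div ln_mult)
        qed simp
      qed
      also have "\<dots> = ln (L\<rho> h / L\<sigma> h) * (\<Sum>c | length c = N. hp h c) +
          (\<Sum>c | length c = N. hp h c * ?r (fst (hd c)) (x c))"
        by (simp add: distrib_left sum.distrib sum_distrib_left mult.commute)
      also have "(\<Sum>c | length c = N. hp h c) = 1" unfolding hp_def by (rule sum_hist_prob)
      finally show ?thesis using 1 hpos by (intro mult_left_mono) auto
    qed simp
    then have "hist_mean \<pi> \<nu> (m + k * N) (\<lambda>h. ln (L\<rho> h / L\<sigma> h) + p / 4 * E h) \<le>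
        hist_mean \<pi> \<nu> (m + k * N + N) (\<lambda>h. ln (L\<rho> h / L\<sigma> h))"
      unfolding hist_mean_append[of \<pi> \<nu> "m + k * N" N] hist_mean_def[of _ _ N]
      unfolding hist_mean_def hp_def[symmetric] by (intro sum_mono) auto
    then show ?thesis
      by (simp only: hist_mean_add hist_mean_cmult KL_def mult_Suc add.assoc add.commute[of N])
  qed
  \<comment> \<open>Telescoping from \<open>KL 0 = 0\<close>, since both likelihoods are 1 at length
    \<open>m\<close>.\<close>
  have KL_ge: "p / 4 * (\<Sum>k<K. hist_mean \<pi> \<nu> (m + k * N) E) \<le> KL K" for K
  proof (induction K)
    case 0
    have "KL 0 = hist_mean \<pi> \<nu> m (\<lambda>h. 0)" unfolding KL_def hist_mean_def using base by (intro sum.cong) auto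
    then show ?case by (simp add: hist_mean_def)
  next
    case (Suc K)
    then show ?case using KL_step[of K] by (simp add: distrib_left)
  qed
  \<comment> \<open>Dominance bounds the likelihood ratio by \<open>1 / w\<close> at every reachable
    boundary history.\<close>
  have KL_le: "KL K \<le> ln (1 / w)" for K
  proof -
    have "hist_prob \<pi> \<nu> h * ln (L\<rho> h / L\<sigma> h) \<le> hist_prob \<pi> \<nu> h * ln (1 / w)" if "length h = m + K * N" for h
    proof (cases "hist_prob \<pi> \<nu> h = 0")
      case False
      then have hpos: "0 < hist_prob \<pi> \<nu> h" using hist_prob_nonneg[of \<pi> \<nu> h] by simp
      have h: "boundary h" using that by (auto simp: boundary_def)
      have "L\<rho> h / L\<sigma> h \<le> 1 / w"
        using dom[OF h] w L\<sigma>_pos[OF h hpos] by (simp add: field_simps)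
      then have "ln (L\<rho> h / L\<sigma> h) \<le> ln (1 / w)"
        using w L\<sigma>_pos[OF h hpos] L\<rho>_pos[OF that hpos] by (subst ln_le_cancel_iff) auto
      then show ?thesis using hpos by (intro mult_left_mono) auto
    qed simp
    then have "KL K \<le> (\<Sum>h | length h = m + K * N. hist_prob \<pi> \<nu> h * ln (1 / w))"
      unfolding KL_def hist_mean_def by (intro sum_mono) auto
    then show ?thesis by (simp only: sum_distrib_right[symmetric] sum_hist_prob mult_1_left)
  qed
  have "summable (\<lambda>k. hist_mean \<pi> \<nu> (m + k * N) E)"
  proof (rule summableI_nonneg_bounded)
    show "0 \<le> hist_mean \<pi> \<nu> (m + k * N) E" for k
      by (intro hist_mean_nonneg) (simp add: E_def sum_nonneg)
    show "(\<Sum>k<K. hist_mean \<pi> \<nu> (m + k * N) E) \<le> 4 / p * ln (1 / w)" for K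
      using order_trans[OF KL_ge[of K] KL_le[of K]] p_pos by (simp add: field_simps)
  qed
  then show ?thesis by (simp add: E_def[abs_def])
qed

end

section \<open>Return and percept predictors\<close>

lemma env_prob_snoc: "env_prob \<nu> (h @ [b]) = env_prob \<nu> h * pmf (\<nu> h (fst b)) (snd b)"
  by (auto simp: env_prob_def nth_append intro!: prod.cong)

lemma env_prob_Nil [simp]: "env_prob \<nu> [] = 1"
  by (simp add: env_prob_def)

text \<open>The general error bound with base length 0 and blocks of length 1; the observed symbol
  is the percept.\<close>

lemma (in exploring) summable_percept_error:
  assumes w: "0 < w" and dom: "\<And>h. w * env_prob \<nu> h \<le> env_prob \<xi> h"
  shows "summable_mean \<pi> \<nu> (\<lambda>h. \<Sum>a\<in>UNIV. \<Sum>e\<in>UNIV. (pmf (\<nu> h a) e - pmf (\<xi> h a) e)\<^sup>2)"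
proof -
  have step: "env_prob \<mu> (h @ c) = env_prob \<mu> h * pmf (\<mu> h (fst (hd c))) (snd (hd c))"
    if "length c = 1" for \<mu> :: "('a, 'o, 'r) env" and h c
    using that by (auto simp: length_Suc_conv env_prob_snoc)
  have "summable (\<lambda>k. hist_mean \<pi> \<nu> (0 + k * 1)
      (\<lambda>h. \<Sum>a\<in>UNIV. \<Sum>e\<in>UNIV. (pmf (\<nu> h a) e - pmf (\<xi> h a) e)\<^sup>2))"
  proof (rule summable_prediction_error[where x="\<lambda>c. snd (hd c)" and L\<rho>="env_prob \<nu>" and L\<sigma>="env_prob \<xi>" and w=w])
    show "hist_mean (\<lambda>g. \<pi> (h @ g)) (\<lambda>g. \<nu> (h @ g)) 1 (\<lambda>c. F (fst (hd c)) (snd (hd c))) =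
        (\<Sum>a\<in>UNIV. pmf (\<pi> h) a * (\<Sum>y\<in>UNIV. pmf (\<nu> h a) y * F a y))" for h F
      by (simp add: hist_mean_Suc_0)
  qed (simp_all add: sum_pmf_UNIV w dom step)
  then show ?thesis by (simp add: summable_mean_def sum_nonneg)
qed

text \<open>One term of a sum of nonnegative terms is at most the sum.\<close>

lemma mixture_predictor_dominates:
  assumes "mixture_predictor M N n P w \<psi>" "\<phi> \<in> P" "g \<in> aug_hists M N n"
  shows "pmf w \<phi> * likelihood N n \<phi> g \<le> likelihood N n \<psi> g"
proof -
  have P: "((\<lambda>\<phi>. pmf w \<phi> * likelihood N n \<phi> g) has_sum likelihood N n \<psi> g) P"
    using assms by (simp add: mixture_predictor_def)
  have single: "((\<lambda>\<phi>. pmf w \<phi> * likelihood N n \<phi> g) has_sum (pmf w \<phi> * likelihood N n \<phi> g)) {\<phi>}"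
    using has_sum_finite[of "{\<phi>}" "\<lambda>\<phi>. pmf w \<phi> * likelihood N n \<phi> g"] by simp
  show ?thesis
    using assms(2) by (intro has_sum_mono_neutral[OF single P]) (auto simp: likelihood_def prod_nonneg)
qed

section \<open>Augmented histories and the error of the return predictors\<close>

locale return_prediction = discounted \<gamma> rew + exploring \<pi> \<nu> p
  for \<gamma> p :: real and rew :: "'r::finite \<Rightarrow> real" and \<pi> :: "('a::finite, 'o::finite, 'r) policy" and \<nu> +
  fixes H M N :: nat
  assumes H_pos: "0 < H" and M_pos: "0 < M" and H_le: "H \<le> N"
begin

definition true_prob :: "('a, 'o, 'r) history \<Rightarrow> 'a \<Rightarrow> real \<Rightarrow> real" where
  "true_prob h a z = measure (continue_from_act \<pi> \<nu> h a) {\<omega>. disc_return \<gamma> rew H M \<omega> 0 = z}"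

text \<open>A block of \<open>N\<close> steps starting at the predicted step contains all
  \<open>H\<close> rewards of that step's return, so the return can be read off the block.\<close>

definition block_return :: "('a, 'o, 'r) history \<Rightarrow> real" where
  "block_return c = disc_return \<gamma> rew H M ((!) c) 0"

lemma block_return_in_zvals: "block_return c \<in> zvals M"
  unfolding block_return_def by (rule disc_return_in_zvals[OF rew \<gamma>_pos \<gamma>_less M_pos])

lemma block_return_prefix: "block_return (map \<omega> [0..<N]) = disc_return \<gamma> rew H M \<omega> 0"
  using H_le by (simp add: block_return_def disc_return_def ret_upto_def reward_at_def)

lemma N_pos: "0 < N"
  using H_pos H_le by simp

text \<open>The first action follows \<open>\<pi>\<close> and, given that action, the return follows
  \<open>true_prob\<close>. This is the hypothesis \<open>law\<close> of the general error
  bound.\<close>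

lemma block_return_law:
  "hist_mean (\<lambda>g. \<pi> (h @ g)) (\<lambda>g. \<nu> (h @ g)) N (\<lambda>c. F (fst (hd c)) (block_return c)) =
    (\<Sum>a\<in>UNIV. pmf (\<pi> h) a * (\<Sum>z\<in>zvals M. true_prob h a z * F a z))"
proof -
  \<comment> \<open>\<open>act a\<close> forces the first action and then follows
    \<open>\<pi>\<close>, as in \<open>continue_from_act\<close>; \<open>q a\<close> is the
    resulting law of blocks.\<close>
  define act where "act a = (\<lambda>g. if g = [] then return_pmf a else \<pi> (h @ g))" for a
  define q where "q a c = hist_prob (act a) (\<lambda>g. \<nu> (h @ g)) c" for a c
  have split: "hist_prob (\<lambda>g. \<pi> (h @ g)) (\<lambda>g. \<nu> (h @ g)) c = pmf (\<pi> h) (fst (hd c)) * q (fst (hd c)) c"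
    and zero: "a \<noteq> fst (hd c) \<Longrightarrow> q a c = 0" if len: "length c = N" for a and c
  proof -
    obtain b g where c: "c = [b] @ g" using len N_pos by (cases c) auto
    have tail: "(\<lambda>g. act a ([b] @ g)) = (\<lambda>g. \<pi> (h @ [b] @ g))" for a by (simp add: act_def)
    have qc: "q a c = pmf (return_pmf a) (fst b) * (pmf (\<nu> h (fst b)) (snd b) *
        hist_prob (\<lambda>g. \<pi> (h @ [b] @ g)) (\<lambda>g. \<nu> (h @ [b] @ g)) g)" for a
      unfolding q_def c hist_prob_append[of _ _ "[b]"] tail
      using hist_prob_snoc[of "act a" "\<lambda>g. \<nu> (h @ g)" "[]" b] pmf_step_pmf[of "act a" "\<lambda>g. \<nu> (h @ g)" "[]" "fst b" "snd b"]
      by (simp add: act_def mult.assoc)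
    show "a \<noteq> fst (hd c) \<Longrightarrow> q a c = 0" by (simp add: qc) (simp add: c)
    show "hist_prob (\<lambda>g. \<pi> (h @ g)) (\<lambda>g. \<nu> (h @ g)) c = pmf (\<pi> h) (fst (hd c)) * q (fst (hd c)) c"
      unfolding qc unfolding c hist_prob_append[of _ _ "[b]"]
      using hist_prob_snoc[of "\<lambda>g. \<pi> (h @ g)" "\<lambda>g. \<nu> (h @ g)" "[]" b]
        pmf_step_pmf[of "\<lambda>g. \<pi> (h @ g)" "\<lambda>g. \<nu> (h @ g)" "[]" "fst b" "snd b"]
      by simp
  qed
  have sum_a: "hist_prob (\<lambda>g. \<pi> (h @ g)) (\<lambda>g. \<nu> (h @ g)) c * F (fst (hd c)) (block_return c) =
      (\<Sum>a\<in>UNIV. pmf (\<pi> h) a * (q a c * F a (block_return c)))" if c: "length c = N" for c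
  proof -
    have "(\<Sum>a\<in>UNIV. pmf (\<pi> h) a * (q a c * F a (block_return c))) =
        (\<Sum>a\<in>{fst (hd c)}. pmf (\<pi> h) a * (q a c * F a (block_return c)))"
      using zero[OF c] by (intro sum.mono_neutral_right) auto
    then show ?thesis by (simp add: split[OF c])
  qed
  \<comment> \<open>Blocks are grouped by their return; the mass of each group is a prefix event of
    the forced interaction.\<close>
  have law: "(\<Sum>c | length c = N. q a c * F a (block_return c)) = (\<Sum>z\<in>zvals M. true_prob h a z * F a z)" for a
  proof -
    have "(\<Sum>c | length c = N. q a c * F a (block_return c)) =
        (\<Sum>z\<in>zvals M. \<Sum>c\<in>{c \<in> {c. length c = N}. block_return c = z}. q a c * F a (block_return c))"
      using block_return_in_zvals by (intro sum.group[symmetric] finite_length_eq finite_zvals) auto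
    also have "\<dots> = (\<Sum>z\<in>zvals M. (\<Sum>c | c \<in> {c. block_return c = z} \<and> length c = N. q a c) * F a z)"
      by (intro sum.cong refl) (auto simp: sum_distrib_right intro!: sum.cong)
    also have "\<dots> = (\<Sum>z\<in>zvals M. true_prob h a z * F a z)"
      using measure_interaction_prefix[of "act a" "\<lambda>g. \<nu> (h @ g)" N "{c. block_return c = z}" for z]
      by (simp add: q_def block_return_prefix true_prob_def continue_from_act_def act_def)
    finally show ?thesis .
  qed
  have "hist_mean (\<lambda>g. \<pi> (h @ g)) (\<lambda>g. \<nu> (h @ g)) N (\<lambda>c. F (fst (hd c)) (block_return c)) =
      (\<Sum>c | length c = N. \<Sum>a\<in>UNIV. pmf (\<pi> h) a * (q a c * F a (block_return c)))"
    unfolding hist_mean_def by (intro sum.cong refl sum_a) simp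
  also have "\<dots> = (\<Sum>a\<in>UNIV. pmf (\<pi> h) a * (\<Sum>c | length c = N. q a c * F a (block_return c)))"
    by (subst sum.swap) (simp add: sum_distrib_left)
  finally show ?thesis unfolding law .
qed

lemma length_aug [simp]: "length (aug \<gamma> rew H M N n h) = length h"
  by (simp add: aug_def aug_outcome_def)

lemma strip_aug: "strip (aug \<gamma> rew H M N n h) = h"
  by (auto simp: strip_def aug_def aug_outcome_def intro!: nth_equalityI)

lemma aug_in_aug_hists: "aug \<gamma> rew H M N n h \<in> aug_hists M N n"
  using disc_return_in_zvals[OF rew \<gamma>_pos \<gamma>_less M_pos]
  by (auto simp: aug_hists_def aug_def aug_outcome_def)

text \<open>The appended block starts at a step of phase \<open>n\<close>. Earlier steps of that
  phase lie at least \<open>N\<close> back, so their returns are settled within \<open>h\<close>;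
  the return inserted at the new step is settled within \<open>c\<close>.\<close>

lemma aug_append:
  assumes n: "n = Suc (length h) mod N" and c: "length c = N"
  shows "take (length h) (aug \<gamma> rew H M N n (h @ c)) = aug \<gamma> rew H M N n h"
    and "aug \<gamma> rew H M N n (h @ c) ! length h = (fst (hd c), Some (block_return c), snd (hd c))"
proof -
  have "take (length h) (aug \<gamma> rew H M N n (h @ c)) = aug_outcome \<gamma> rew H M N n ((!) (h @ c)) (length h)"
    by (simp add: aug_def aug_outcome_def take_map)
  also have "\<dots> = aug \<gamma> rew H M N n (map ((!) (h @ c)) [0..<length h])"
    by (rule aug_prefix[OF H_pos H_le n, symmetric])
  also have "map ((!) (h @ c)) [0..<length h] = h"
    by (intro nth_equalityI) (auto simp: nth_append)
  finally show "take (length h) (aug \<gamma> rew H M N n (h @ c)) = aug \<gamma> rew H M N n h" .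
  have "c \<noteq> []" using c N_pos by auto
  then show "aug \<gamma> rew H M N n (h @ c) ! length h = (fst (hd c), Some (block_return c), snd (hd c))"
    using n c N_pos
    by (simp add: aug_def aug_outcome_def nth_append hd_conv_nth block_return_def disc_return_def
        ret_upto_def reward_at_def)
qed

lemma likelihood_aug_append:
  assumes n: "n = Suc (length h) mod N" and c: "length c = N"
  shows "likelihood N n \<phi> (aug \<gamma> rew H M N n (h @ c)) =
    likelihood N n \<phi> (aug \<gamma> rew H M N n h) * pmf (\<phi> (aug \<gamma> rew H M N n h) (fst (hd c))) (block_return c)"
proof -
  let ?m = "length h" and ?g = "aug \<gamma> rew H M N n (h @ c)" and ?g' = "aug \<gamma> rew H M N n h"
  let ?I = "{i. i < ?m \<and> Suc i mod N = n}"
  \<comment> \<open>Another position of the same phase after \<open>?m\<close> would lie at least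
    \<open>N\<close> further on, outside the block.\<close>
  have "i \<le> ?m" if i: "i < ?m + N" "Suc i mod N = n" for i
  proof (rule ccontr)
    assume "\<not> i \<le> ?m"
    then have "N dvd Suc i - Suc ?m" using i n by (intro mod_eq_dvd_iff_nat[THEN iffD1]) auto
    then have "N \<le> i - ?m" using \<open>\<not> i \<le> ?m\<close> by (intro dvd_imp_le) auto
    then show False using i \<open>\<not> i \<le> ?m\<close> by linarith
  qed
  then have I: "{i. i < length (h @ c) \<and> Suc i mod N = n} = insert ?m ?I"
    using n c N_pos by (auto simp: le_less)
  have tk: "take i ?g = take i ?g'" "?g ! i = ?g' ! i" if "i < ?m" for i
    unfolding aug_append(1)[OF n c, symmetric] using that by (simp_all add: min_def)
  show ?thesis
    unfolding likelihood_def length_aug I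
    by (subst prod.insert) (auto simp: aug_append[OF n c] tk intro!: prod.cong)
qed

text \<open>The next step is the first of its phase, so the product is empty; this is the base case
  of the error bound.\<close>

lemma likelihood_aug_short:
  assumes "length h < N" "n = Suc (length h) mod N"
  shows "likelihood N n \<phi> (aug \<gamma> rew H M N n h) = 1"
proof -
  have empty: "{i. i < length h \<and> Suc i mod N = n} = {}"
    using assms by (cases "Suc (length h) = N") auto
  show ?thesis unfolding likelihood_def length_aug empty by simp
qed

text \<open>Within a phase, predictions are \<open>N\<close> steps apart, so each return is revealed
  before the next prediction. The general error bound therefore applies to each residue of the
  history length, and the residues are then combined.\<close>

lemma summable_return_error:
  assumes mix: "\<And>n. n < N \<Longrightarrow> mixture_predictor M N n (\<P> n) (w n) (\<psi> n)"
    and truth: "grain_of_truth \<gamma> rew H M N \<P> \<pi> \<nu>"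
  shows "summable_mean \<pi> \<nu> (\<lambda>h. \<Sum>a\<in>UNIV. \<Sum>z\<in>zvals M.
    (true_prob h a z - pmf (unified \<gamma> rew H M N \<psi> h a) z)\<^sup>2)"
proof -
  let ?E = "\<lambda>h. \<Sum>a\<in>UNIV. \<Sum>z\<in>zvals M. (true_prob h a z - pmf (unified \<gamma> rew H M N \<psi> h a) z)\<^sup>2"
  have E0: "0 \<le> ?E h" for h by (intro sum_nonneg) auto
  have "summable (\<lambda>t. hist_mean \<pi> \<nu> t ?E)"
  proof (rule summable_residues[OF hist_mean_nonneg[OF E0] N_pos])
    fix m assume m: "m < N"
    \<comment> \<open>A history of length \<open>m\<close> precedes time \<open>Suc m\<close>, hence
      the shift.\<close>
    define n where "n = Suc m mod N"
    have n: "n < N" using N_pos by (simp add: n_def)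
    define A :: "('a, 'o, 'r) history \<Rightarrow> ('a, 'o, 'r) aug_history" where "A = aug \<gamma> rew H M N n"
    obtain \<phi> where \<phi>: "\<phi> \<in> \<P> n" and \<phi>_true: "\<And>g a z. pred_point M N n g \<Longrightarrow> z \<in> zvals M \<Longrightarrow>
        pmf (\<phi> g a) z = true_prob (strip g) a z"
      using truth n unfolding grain_of_truth_def true_prob_def by blast
    have len: "Suc (length h) mod N = n" if "\<exists>k. length h = m + k * N" for h :: "('a, 'o, 'r) history"
      using that by (auto simp: n_def simp flip: add_Suc)
    \<comment> \<open>Boundary histories augment to genuine prediction points, where the true
      predictor and \<open>\<phi>\<close> agree and predictors are supported on
      \<open>zvals M\<close>.\<close>
    have point: "pred_point M N n (A h)" if "\<exists>k. length h = m + k * N" for h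
      using len[OF that] aug_in_aug_hists by (simp add: pred_point_def A_def)
    have A_true: "pmf (\<phi> (A h) a) z = true_prob h a z" if "\<exists>k. length h = m + k * N" "z \<in> zvals M" for h a z
      using \<phi>_true[OF point[OF that(1)] that(2)] by (simp add: A_def strip_aug)
    have \<psi>: "unified \<gamma> rew H M N \<psi> h a = \<psi> n (A h) a" if "\<exists>k. length h = m + k * N" for h a
      using len[OF that] by (simp add: unified_def A_def Let_def)
    have pred: "return_predictor M N n \<phi>" "return_predictor M N n (\<psi> n)"
      using mix[OF n] \<phi> by (auto simp: mixture_predictor_def)
    have pred_sum: "sum (pmf (f (A h) a)) (zvals M) = 1"
      if "return_predictor M N n f" "\<exists>k. length h = m + k * N" for f h a
      using that(1) point[OF that(2)] by (intro sum_pmf_eq_1) (auto simp: return_predictor_def)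
    show "summable (\<lambda>k. hist_mean \<pi> \<nu> (m + k * N) ?E)"
    proof (rule summable_prediction_error[where x=block_return and L\<rho>="\<lambda>h. likelihood N n \<phi> (A h)"
          and L\<sigma>="\<lambda>h. likelihood N n (\<psi> n) (A h)" and w="pmf (w n) \<phi>"])
      fix h :: "('a, 'o, 'r) history" assume h: "\<exists>k. length h = m + k * N"
      show "sum (true_prob h a) (zvals M) = 1" for a
        using pred_sum[OF pred(1) h, of a] by (simp add: A_true[OF h])
      show "sum (pmf (unified \<gamma> rew H M N \<psi> h a)) (zvals M) = 1" for a
        using pred_sum[OF pred(2) h] by (simp add: \<psi>[OF h])
      show "pmf (w n) \<phi> * likelihood N n \<phi> (A h) \<le> likelihood N n (\<psi> n) (A h)"
        unfolding A_def by (rule mixture_predictor_dominates[OF mix[OF n] \<phi> aug_in_aug_hists])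
      show "hist_mean (\<lambda>g. \<pi> (h @ g)) (\<lambda>g. \<nu> (h @ g)) N (\<lambda>c. F (fst (hd c)) (block_return c)) =
          (\<Sum>a\<in>UNIV. pmf (\<pi> h) a * (\<Sum>y\<in>zvals M. true_prob h a y * F a y))" for F
        by (rule block_return_law)
      fix c :: "('a, 'o, 'r) history" assume c: "length c = N"
      note likelihood_step = likelihood_aug_append[OF len[OF h, symmetric] c, folded A_def]
      show "likelihood N n \<phi> (A (h @ c)) = likelihood N n \<phi> (A h) * true_prob h (fst (hd c)) (block_return c)"
        unfolding likelihood_step by (simp add: A_true[OF h block_return_in_zvals])
      show "likelihood N n (\<psi> n) (A (h @ c)) =
          likelihood N n (\<psi> n) (A h) * pmf (unified \<gamma> rew H M N \<psi> h (fst (hd c))) (block_return c)"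
        unfolding likelihood_step \<psi>[OF h] ..
    next
      show "0 < pmf (w n) \<phi>" using mix[OF n] \<phi> by (auto simp: mixture_predictor_def pmf_positive_iff)
    qed (auto simp: block_return_in_zvals true_prob_def A_def n_def m likelihood_aug_short)
  qed
  then show ?thesis using E0 by (simp add: summable_mean_def)
qed

end

section \<open>Asymptotic optimality\<close>

text \<open>Turns summable squared errors into absolute errors at an additive cost
  \<open>\<delta>\<close>. Each term uses \<open>\<bar>t\<bar> \<le> s + t\<^sup>2 / s\<close>,
  which follows from the square of \<open>\<bar>t\<bar> - s\<close>; the choice of \<open>s\<close>
  spreads \<open>\<delta>\<close> evenly over \<open>X\<close>.\<close>

lemma sum_abs_le_sum_squares:
  fixes f :: "'x \<Rightarrow> real"
  assumes "0 < \<delta>"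
  shows "(\<Sum>x\<in>X. \<bar>f x\<bar>) \<le> \<delta> + card X / \<delta> * (\<Sum>x\<in>X. (f x)\<^sup>2)"
proof (cases "card X = 0")
  \<comment> \<open>This covers infinite \<open>X\<close> too, over which sums are 0 by
    convention.\<close>
  case True
  then show ?thesis using assms by (auto simp: card_eq_0_iff)
next
  case False
  define s where "s = \<delta> / card X"
  have s: "0 < s" using False assms by (simp add: s_def)
  have "\<bar>t\<bar> \<le> s + t\<^sup>2 / s" for t :: real
  proof -
    have "0 \<le> (\<bar>t\<bar> - s)\<^sup>2 + \<bar>t\<bar> * s" using s by simp
    then have "\<bar>t\<bar> * s \<le> (s + t\<^sup>2 / s) * s"
      using s by (simp add: power2_diff distrib_right) (simp add: power2_eq_square mult.commute)
    then show ?thesis using s by simp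
  qed
  then have "(\<Sum>x\<in>X. \<bar>f x\<bar>) \<le> (\<Sum>x\<in>X. s + (f x)\<^sup>2 / s)" by (intro sum_mono)
  also have "\<dots> = \<delta> + card X / \<delta> * (\<Sum>x\<in>X. (f x)\<^sup>2)"
    using False by (simp add: sum.distrib s_def sum_divide_distrib sum_distrib_left mult.commute)
  finally show ?thesis .
qed

text \<open>Inserting percepts from \<open>\<nu>\<close> with continuation value \<open>W\<close>
  separates the percept error from the difference of continuation values.\<close>

lemma (in discounted) backup_diff:
  "backup \<gamma> rew \<nu> V h a - backup \<gamma> rew \<xi> W h a =
    (\<Sum>e\<in>UNIV. (pmf (\<nu> h a) e - pmf (\<xi> h a) e) * ((1 - \<gamma>) * rew (snd e) + \<gamma> * W (h @ [(a, e)]))) +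
    \<gamma> * (\<Sum>e\<in>UNIV. pmf (\<nu> h a) e * (V (h @ [(a, e)]) - W (h @ [(a, e)])))"
  unfolding backup_def sum_distrib_left sum.distrib[symmetric] sum_subtractf[symmetric]
  by (intro sum.cong refl) (simp add: algebra_simps)

lemma (in discounted) abs_backup_diff_le:
  assumes "\<And>g. 0 \<le> W g" "\<And>g. W g \<le> 1"
  shows "\<bar>backup \<gamma> rew \<nu> V h a - backup \<gamma> rew \<xi> W h a\<bar> \<le>
    (\<Sum>e\<in>UNIV. \<bar>pmf (\<nu> h a) e - pmf (\<xi> h a) e\<bar>) +
    \<gamma> * (\<Sum>e\<in>UNIV. pmf (\<nu> h a) e * \<bar>V (h @ [(a, e)]) - W (h @ [(a, e)])\<bar>)"
proof -
  have unit: "\<bar>(1 - \<gamma>) * rew x + \<gamma> * W g\<bar> \<le> 1" for x g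
  proof -
    have "0 \<le> (1 - \<gamma>) * rew x + \<gamma> * W g" using assms rew_bounds \<gamma>_pos \<gamma>_less by simp
    moreover have "(1 - \<gamma>) * rew x + \<gamma> * W g \<le> (1 - \<gamma>) * 1 + \<gamma> * 1"
      using assms rew_bounds \<gamma>_pos \<gamma>_less by (intro add_mono mult_left_mono) auto
    ultimately show ?thesis by simp
  qed
  have "\<bar>\<Sum>e\<in>UNIV. (pmf (\<nu> h a) e - pmf (\<xi> h a) e) * ((1 - \<gamma>) * rew (snd e) + \<gamma> * W (h @ [(a, e)]))\<bar> \<le>
      (\<Sum>e\<in>UNIV. \<bar>pmf (\<nu> h a) e - pmf (\<xi> h a) e\<bar>)"
    using unit by (intro order_trans[OF sum_abs] sum_mono) (auto simp: abs_mult intro!: mult_left_le)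
  moreover have "\<bar>\<gamma> * (\<Sum>e\<in>UNIV. pmf (\<nu> h a) e * (V (h @ [(a, e)]) - W (h @ [(a, e)])))\<bar> \<le>
      \<gamma> * (\<Sum>e\<in>UNIV. pmf (\<nu> h a) e * \<bar>V (h @ [(a, e)]) - W (h @ [(a, e)])\<bar>)"
    unfolding abs_mult using \<gamma>_pos by (intro mult_mono order_trans[OF sum_abs]) (auto simp: abs_mult)
  ultimately show ?thesis unfolding backup_diff by linarith
qed

text \<open>Changing the distribution costs the L1 distance. It moves expectations from
  \<open>\<xi>\<close> to \<open>\<nu>\<close>, under which negligible functions are stable.\<close>

lemma expectation_diff_le:
  fixes p q :: "'x::finite pmf"
  assumes "\<And>x. \<bar>f x\<bar> \<le> 1"
  shows "(\<Sum>x\<in>UNIV. pmf q x * f x) \<le> (\<Sum>x\<in>UNIV. \<bar>pmf p x - pmf q x\<bar>) + (\<Sum>x\<in>UNIV. pmf p x * f x)"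
  unfolding sum.distrib[symmetric]
proof (intro sum_mono)
  fix x
  have "(pmf q x - pmf p x) * f x \<le> \<bar>pmf p x - pmf q x\<bar> * \<bar>f x\<bar>"
    by (metis abs_ge_self abs_minus_commute abs_mult)
  also have "\<dots> \<le> \<bar>pmf p x - pmf q x\<bar>" using assms by (intro mult_left_le) auto
  finally show "pmf q x * f x \<le> \<bar>pmf p x - pmf q x\<bar> + pmf p x * f x" by (simp add: algebra_simps)
qed

lemma aiqi_policy_exploring:
  assumes "aiqi_policy \<gamma> rew H M N \<tau> \<psi> \<pi>" "\<tau> \<le> 1"
  shows "\<tau> / real CARD('a) \<le> pmf (\<pi> h) (a :: 'a::finite)"
proof -
  obtain p where "\<forall>a. pmf (\<pi> h) a = (1 - \<tau>) * pmf p a + \<tau> / real CARD('a)"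
    using assms(1) unfolding aiqi_policy_def by blast
  then show ?thesis using assms(2) by simp
qed

lemma expectation_ge_support:
  fixes p :: "'x::finite pmf"
  assumes "\<And>x. x \<in> set_pmf p \<Longrightarrow> c \<le> f x"
  shows "c \<le> (\<Sum>x\<in>UNIV. pmf p x * f x)"
proof -
  have "(\<Sum>x\<in>UNIV. pmf p x * c) \<le> (\<Sum>x\<in>UNIV. pmf p x * f x)"
  proof (rule sum_mono)
    fix x show "pmf p x * c \<le> pmf p x * f x"
      using assms by (cases "x \<in> set_pmf p") (auto simp: set_pmf_iff intro: mult_left_mono)
  qed
  then show ?thesis by (simp add: sum_distrib_right[symmetric] sum_pmf_UNIV)
qed

context return_prediction
begin

text \<open>A maximizer of \<open>Q_hat\<close> loses at most \<open>u + v\<close> in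
  \<open>Q\<close> against any action, and the uniform exploration part loses at most
  \<open>\<tau>\<close> because \<open>Q\<close> lies in the unit interval.\<close>

lemma aiqi_policy_near_greedy:
  fixes Q :: "'a \<Rightarrow> real"
  assumes pol: "aiqi_policy \<gamma> rew H M N \<tau> \<psi> \<pi>" and \<tau>: "0 < \<tau>" "\<tau> \<le> 1"
    and Q: "\<And>a. 0 \<le> Q a" "\<And>a. Q a \<le> 1"
    and le: "\<And>a. Q_hat \<gamma> rew H M N \<psi> h a \<le> Q a + u" and ge: "\<And>a. Q a \<le> Q_hat \<gamma> rew H M N \<psi> h a + v"
    and "0 \<le> u" "0 \<le> v"
  shows "Q b \<le> (\<Sum>a\<in>UNIV. pmf (\<pi> h) a * Q a) + (\<tau> + u + v)"
proof -
  obtain p where p: "set_pmf p \<subseteq> {a. is_arg_max (Q_hat \<gamma> rew H M N \<psi> h) (\<lambda>_. True) a}"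
    and \<pi>: "\<And>a. pmf (\<pi> h) a = (1 - \<tau>) * pmf p a + \<tau> / real CARD('a)"
    using pol unfolding aiqi_policy_def by metis
  have "Q b - (u + v) \<le> Q a" if "a \<in> set_pmf p" for a
  proof -
    have "Q_hat \<gamma> rew H M N \<psi> h b \<le> Q_hat \<gamma> rew H M N \<psi> h a"
      using that p by (auto simp: is_arg_max_def not_less)
    then show ?thesis using le[of a] ge[of b] by simp
  qed
  then have "Q b - (u + v) \<le> (\<Sum>a\<in>UNIV. pmf p a * Q a)" by (rule expectation_ge_support)
  then have "(1 - \<tau>) * (Q b - (u + v)) \<le> (1 - \<tau>) * (\<Sum>a\<in>UNIV. pmf p a * Q a)"
    using \<tau> by (intro mult_left_mono) auto
  also have "\<dots> = (\<Sum>a\<in>UNIV. ((1 - \<tau>) * pmf p a) * Q a)"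
    by (simp add: sum_distrib_left mult.assoc)
  \<comment> \<open>The exploration part of the policy contributes a nonnegative amount.\<close>
  also have "\<dots> \<le> (\<Sum>a\<in>UNIV. pmf (\<pi> h) a * Q a)"
    using \<tau> Q by (intro sum_mono mult_right_mono) (auto simp: \<pi>)
  finally have "(1 - \<tau>) * (Q b - (u + v)) \<le> (\<Sum>a\<in>UNIV. pmf (\<pi> h) a * Q a)" .
  moreover have "\<tau> * Q b \<le> \<tau>" using \<tau> Q by (intro mult_left_le) auto
  moreover have "0 \<le> \<tau> * (u + v)" using \<tau> assms by simp
  ultimately show ?thesis by (simp add: algebra_simps)
qed

text \<open>Histories are drawn with \<open>\<nu>\<close>, while the values are those in
  \<open>\<xi>\<close>. Predicted returns approximate action values in \<open>\<nu>\<close>; a first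
  recursion carries these over to \<open>\<xi>\<close>; near-greediness follows, and a second
  recursion bounds the gap.\<close>

lemma value_gap_bound:
  assumes mix: "\<And>n. n < N \<Longrightarrow> mixture_predictor M N n (\<P> n) (\<omega> n) (\<psi> n)"
    and truth: "grain_of_truth \<gamma> rew H M N \<P> \<pi> \<nu>"
    and pol: "aiqi_policy \<gamma> rew H M N \<tau> \<psi> \<pi>" and \<tau>: "0 < \<tau>" "\<tau> \<le> 1"
    and w: "0 < w" and dom: "\<And>h. w * env_prob \<nu> h \<le> env_prob \<xi> h"
    and \<theta>: "0 < \<theta>"
  shows "\<exists>g. summable_mean \<pi> \<nu> g \<and> (\<forall>h. opt_value \<gamma> rew \<xi> h - policy_value \<gamma> rew \<pi> \<xi> h \<le>
    (\<tau> + (1 / real M + \<gamma> ^ H)) / (1 - \<gamma>) + \<theta> + g h)"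
proof -
  \<comment> \<open>Chosen so that nine times \<open>\<delta> / (1 - \<gamma>)\<close>, which bounds
    \<open>2 * c + \<delta>\<close> below, equals
    \<open>\<theta> * (1 - \<gamma>) / 2\<close>.\<close>
  define \<delta> where "\<delta> = \<theta> * (1 - \<gamma>)\<^sup>2 / 18"
  have \<delta>: "0 < \<delta>" using \<theta> \<gamma>_less by (simp add: \<delta>_def)
  define \<kappa> where "\<kappa> = 1 / real M + \<gamma> ^ H"
  have \<kappa>: "0 \<le> \<kappa>" using \<gamma>_pos by (simp add: \<kappa>_def)
  let ?Vn = "policy_value \<gamma> rew \<pi> \<nu>" and ?Vx = "policy_value \<gamma> rew \<pi> \<xi>" and ?Vo = "opt_value \<gamma> rew \<xi>"
  let ?Qn = "backup \<gamma> rew \<nu> ?Vn" and ?Qx = "backup \<gamma> rew \<xi> ?Vx"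
  let ?Qh = "Q_hat \<gamma> rew H M N \<psi>"
  let ?d = "\<lambda>h a. \<Sum>e\<in>UNIV. \<bar>pmf (\<nu> h a) e - pmf (\<xi> h a) e\<bar>"
  let ?q = "\<lambda>h a. \<Sum>z\<in>zvals M. z * true_prob h a z"

  obtain D where D: "summable_mean \<pi> \<nu> D" "\<And>h a. ?d h a \<le> \<delta> + D h"
  proof
    let ?D = "\<lambda>h. real CARD('o \<times> 'r) / \<delta> * (\<Sum>a\<in>UNIV. \<Sum>e\<in>UNIV. (pmf (\<nu> h a) e - pmf (\<xi> h a) e)\<^sup>2)"
    show "summable_mean \<pi> \<nu> ?D"
      using \<delta> by (intro summable_mean_cmult summable_percept_error[OF w dom]) auto
    fix h :: "('a, 'o, 'r) history" and a :: 'a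
    have "(\<Sum>e\<in>UNIV. (pmf (\<nu> h a) e - pmf (\<xi> h a) e)\<^sup>2) \<le> (\<Sum>a\<in>UNIV. \<Sum>e\<in>UNIV. (pmf (\<nu> h a) e - pmf (\<xi> h a) e)\<^sup>2)"
      by (rule member_le_sum[of a UNIV "\<lambda>a. \<Sum>e\<in>UNIV. (pmf (\<nu> h a) e - pmf (\<xi> h a) e)\<^sup>2"]) (auto intro: sum_nonneg)
    then have "real CARD('o \<times> 'r) / \<delta> * (\<Sum>e\<in>UNIV. (pmf (\<nu> h a) e - pmf (\<xi> h a) e)\<^sup>2) \<le> ?D h"
      using \<delta> by (intro mult_left_mono) auto
    then show "?d h a \<le> \<delta> + ?D h"
      using sum_abs_le_sum_squares[OF \<delta>, of "\<lambda>e. pmf (\<nu> h a) e - pmf (\<xi> h a) e" UNIV] by linarith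
  qed
  obtain G where G: "summable_mean \<pi> \<nu> G" "\<And>h a. \<bar>?q h a - ?Qh h a\<bar> \<le> \<delta> + G h"
  proof
    let ?r = "\<lambda>h a z. true_prob h a z - pmf (unified \<gamma> rew H M N \<psi> h a) z"
    let ?G = "\<lambda>h. real (card (zvals M)) / \<delta> * (\<Sum>a\<in>UNIV. \<Sum>z\<in>zvals M. (?r h a z)\<^sup>2)"
    show "summable_mean \<pi> \<nu> ?G"
      using \<delta> by (intro summable_mean_cmult summable_return_error[OF mix truth]) auto
    fix h :: "('a, 'o, 'r) history" and a :: 'a
    have "?q h a - ?Qh h a = (\<Sum>z\<in>zvals M. z * ?r h a z)"
      by (simp add: Q_hat_def right_diff_distrib sum_subtractf)
    also have "\<bar>\<dots>\<bar> \<le> (\<Sum>z\<in>zvals M. \<bar>?r h a z\<bar>)"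
      using zvals_bounds by (intro order_trans[OF sum_abs] sum_mono) (auto simp: abs_mult intro!: mult_left_le_one_le)
    also have "\<dots> \<le> \<delta> + real (card (zvals M)) / \<delta> * (\<Sum>z\<in>zvals M. (?r h a z)\<^sup>2)"
      by (rule sum_abs_le_sum_squares[OF \<delta>])
    also have "(\<Sum>z\<in>zvals M. (?r h a z)\<^sup>2) \<le> (\<Sum>a\<in>UNIV. \<Sum>z\<in>zvals M. (?r h a z)\<^sup>2)"
      by (rule member_le_sum[of a UNIV "\<lambda>a. \<Sum>z\<in>zvals M. (?r h a z)\<^sup>2"]) (auto intro: sum_nonneg)
    finally show "\<bar>?q h a - ?Qh h a\<bar> \<le> \<delta> + ?G h" using \<delta> by (simp add: mult_left_mono divide_right_mono)
  qed
  note D0 = summable_mean_nonneg[OF D(1)] and G0 = summable_mean_nonneg[OF G(1)]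

  have Qdiff: "\<bar>?Qn h a - ?Qx h a\<bar> \<le> \<delta> + D h + \<gamma> * (\<Sum>e\<in>UNIV. pmf (\<nu> h a) e * \<bar>?Vn (h @ [(a, e)]) - ?Vx (h @ [(a, e)])\<bar>)" for h a
    using abs_backup_diff_le[of ?Vx \<nu> ?Vn h a \<xi>, OF policy_value_bounds] D(2)[of h a] by linarith
  \<comment> \<open>First recursion: the values of \<open>\<pi>\<close> in \<open>\<nu>\<close> and
    \<open>\<xi>\<close> differ only through percept errors, which are \<open>\<delta>\<close> plus
    the negligible \<open>D\<close>.\<close>
  have "\<exists>g. summable_mean \<pi> \<nu> g \<and> (\<forall>h. \<bar>?Vn h - ?Vx h\<bar> \<le> \<delta> / (1 - \<gamma>) + \<delta> + g h)"
  proof (rule discounted_recursion_bound[OF \<gamma>_pos \<gamma>_less _ less_imp_le[OF \<delta>] D(1) _ \<delta>])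
    fix h
    show "\<bar>?Vn h - ?Vx h\<bar> \<le> 1"
      using policy_value_bounds[of \<pi> \<nu> h] policy_value_bounds[of \<pi> \<xi> h] by linarith
    have eq: "?Vn h - ?Vx h = (\<Sum>a\<in>UNIV. pmf (\<pi> h) a * (?Qn h a - ?Qx h a))"
      unfolding policy_value_step[of _ _ h] by (simp add: right_diff_distrib sum_subtractf)
    have le: "\<bar>?Vn h - ?Vx h\<bar> \<le> (\<Sum>a\<in>UNIV. pmf (\<pi> h) a * \<bar>?Qn h a - ?Qx h a\<bar>)"
      unfolding eq by (rule order_trans[OF sum_abs]) (simp add: abs_mult)
    from expectation_le_max[of "\<pi> h" "\<lambda>a. \<bar>?Qn h a - ?Qx h a\<bar>"]
    obtain a where "(\<Sum>a\<in>UNIV. pmf (\<pi> h) a * \<bar>?Qn h a - ?Qx h a\<bar>) \<le> \<bar>?Qn h a - ?Qx h a\<bar>" ..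
    from order_trans[OF le order_trans[OF this Qdiff]] show "\<exists>a. \<bar>?Vn h - ?Vx h\<bar> \<le> \<delta> + D h +
        \<gamma> * (\<Sum>e\<in>UNIV. pmf (\<nu> h a) e * \<bar>?Vn (h @ [(a, e)]) - ?Vx (h @ [(a, e)])\<bar>)"
      by (rule exI)
  qed
  then obtain g where g: "summable_mean \<pi> \<nu> g" "\<And>h. \<bar>?Vn h - ?Vx h\<bar> \<le> \<delta> / (1 - \<gamma>) + \<delta> + g h"
    by blast
  define E where "E h = D h + next_sum \<nu> g h + G h" for h
  \<comment> \<open>One \<open>\<delta>\<close> each from return errors, percept errors and the
    slack of the recursion, and \<open>\<delta> / (1 - \<gamma>)\<close> from accumulated percept
    errors.\<close>
  define c where "c = \<delta> / (1 - \<gamma>) + 3 * \<delta>"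
  have E: "summable_mean \<pi> \<nu> E"
    unfolding E_def by (intro summable_mean_add D G summable_mean_next_sum g)
  have E0: "0 \<le> E h" for h using E by (rule summable_mean_nonneg)
  have c0: "0 \<le> c" using \<delta> \<gamma>_less by (simp add: c_def)
  \<comment> \<open>The discretized return only underestimates, so \<open>\<kappa>\<close> enters in
    one direction and is paid once.\<close>
  have Q_close: "?Qh h a \<le> ?Qx h a + (c + E h)" "?Qx h a \<le> ?Qh h a + (\<kappa> + c + E h)" for h a
  proof -
    have "(\<Sum>e\<in>UNIV. pmf (\<nu> h a) e * \<bar>?Vn (h @ [(a, e)]) - ?Vx (h @ [(a, e)])\<bar>) \<le>
        (\<Sum>e\<in>UNIV. pmf (\<nu> h a) e * (\<delta> / (1 - \<gamma>) + \<delta> + g (h @ [(a, e)])))"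
      by (intro sum_mono mult_left_mono g) auto
    also have "\<dots> = (\<Sum>e\<in>UNIV. pmf (\<nu> h a) e) * (\<delta> / (1 - \<gamma>) + \<delta>) + (\<Sum>e\<in>UNIV. pmf (\<nu> h a) e * g (h @ [(a, e)]))"
      by (simp only: distrib_left[of "pmf _ _"] sum.distrib sum_distrib_right)
    also have "\<dots> \<le> \<delta> / (1 - \<gamma>) + \<delta> + next_sum \<nu> g h"
      using expectation_le_next_sum[OF summable_mean_nonneg[OF g(1)], of \<nu> h a] by (simp add: sum_pmf_UNIV)
    finally have sum: "(\<Sum>e\<in>UNIV. pmf (\<nu> h a) e * \<bar>?Vn (h @ [(a, e)]) - ?Vx (h @ [(a, e)])\<bar>) \<le>
        \<delta> / (1 - \<gamma>) + \<delta> + next_sum \<nu> g h" .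
    have "\<gamma> * (\<Sum>e\<in>UNIV. pmf (\<nu> h a) e * \<bar>?Vn (h @ [(a, e)]) - ?Vx (h @ [(a, e)])\<bar>) \<le>
        (\<Sum>e\<in>UNIV. pmf (\<nu> h a) e * \<bar>?Vn (h @ [(a, e)]) - ?Vx (h @ [(a, e)])\<bar>)"
      using \<gamma>_pos \<gamma>_less by (intro mult_left_le_one_le sum_nonneg) auto
    with sum Qdiff[of h a] have "\<bar>?Qn h a - ?Qx h a\<bar> \<le> 2 * \<delta> + \<delta> / (1 - \<gamma>) + D h + next_sum \<nu> g h"
      by linarith
    moreover have "?q h a \<le> ?Qn h a" "?Qn h a \<le> ?q h a + \<kappa>"
      using expected_disc_return_bounds[OF M_pos, where \<pi>=\<pi> and \<nu>=\<nu> and H=H and h=h and a=a]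
      by (simp_all add: true_prob_def \<kappa>_def)
    ultimately show "?Qh h a \<le> ?Qx h a + (c + E h)" "?Qx h a \<le> ?Qh h a + (\<kappa> + c + E h)"
      using G(2)[of h a] by (auto simp: c_def E_def)
  qed
  have greedy: "?Qx h b \<le> ?Vx h + (\<tau> + \<kappa> + 2 * c + 2 * E h)" for h b
    using aiqi_policy_near_greedy[OF pol \<tau> backup_bounds[OF policy_value_bounds] Q_close(1) Q_close(2), of h b] c0 E0[of h] \<kappa>
    unfolding policy_value_step[of \<pi> \<xi> h] by (simp add: algebra_simps)

  \<comment> \<open>Second recursion: the optimal action backs up the optimal value, near-greediness
    compares it with \<open>?Vx\<close>, and the remaining expectation is moved from
    \<open>\<xi>\<close> to \<open>\<nu>\<close>.\<close>
  have bound: "\<exists>g. summable_mean \<pi> \<nu> g \<and> (\<forall>h. ?Vo h - ?Vx h \<le> (\<tau> + \<kappa> + 2 * c + \<delta>) / (1 - \<gamma>) + \<theta> / 2 + g h)"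
  proof (rule discounted_recursion_bound[OF \<gamma>_pos \<gamma>_less _ _ summable_mean_add[OF summable_mean_add[OF E E] D(1)]])
    fix h
    show "?Vo h - ?Vx h \<le> 1"
      using policy_value_bounds[of \<pi> \<xi> h] opt_value_bounds[of \<xi> h] by linarith
    obtain a where a: "?Vo h \<le> backup \<gamma> rew \<xi> ?Vo h a" using opt_value_le_backup by blast
    let ?S = "\<lambda>\<mu>. \<Sum>e\<in>UNIV. pmf (\<mu> h a) e * (?Vo (h @ [(a, e)]) - ?Vx (h @ [(a, e)]))"
    \<comment> \<open>Both backups use \<open>\<xi>\<close>, so the percept term of
      \<open>backup_diff\<close> vanishes.\<close>
    have "backup \<gamma> rew \<xi> ?Vo h a - ?Qx h a = \<gamma> * ?S \<xi>"
      by (subst backup_diff) simp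
    moreover have "?S \<xi> \<le> ?d h a + ?S \<nu>"
    proof (rule expectation_diff_le)
      show "\<bar>?Vo (h @ [(a, e)]) - ?Vx (h @ [(a, e)])\<bar> \<le> 1" for e
        using policy_value_bounds[of \<pi> \<xi> "h @ [(a, e)]"] opt_value_bounds[of \<xi> "h @ [(a, e)]"] by linarith
    qed
    then have "\<gamma> * ?S \<xi> \<le> \<gamma> * ?d h a + \<gamma> * ?S \<nu>"
      using \<gamma>_pos by (simp add: distrib_left[symmetric])
    moreover have "\<gamma> * ?d h a \<le> ?d h a"
      using \<gamma>_pos \<gamma>_less by (intro mult_left_le_one_le sum_nonneg) auto
    ultimately have "?Vo h - ?Vx h \<le> \<tau> + \<kappa> + 2 * c + \<delta> + (E h + E h + D h) + \<gamma> * ?S \<nu>"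
      using a greedy[of h a] D(2)[of h a] by linarith
    then show "\<exists>a. ?Vo h - ?Vx h \<le> \<tau> + \<kappa> + 2 * c + \<delta> + (E h + E h + D h) +
        \<gamma> * (\<Sum>e\<in>UNIV. pmf (\<nu> h a) e * (?Vo (h @ [(a, e)]) - ?Vx (h @ [(a, e)])))"
      by blast
  qed (use \<tau> \<kappa> c0 \<delta> \<theta> in auto)
  have le: "(\<tau> + \<kappa> + 2 * c + \<delta>) / (1 - \<gamma>) \<le> (\<tau> + \<kappa>) / (1 - \<gamma>) + \<theta> / 2"
  proof -
    have "\<delta> \<le> \<delta> / (1 - \<gamma>)" using \<delta> \<gamma>_pos \<gamma>_less by (simp add: field_simps)
    moreover have "\<delta> / (1 - \<gamma>) = \<theta> * (1 - \<gamma>) / 18"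
      using \<gamma>_less by (simp only: \<delta>_def nonzero_divide_eq_eq) (simp add: power2_eq_square)
    ultimately have "2 * c + \<delta> \<le> \<theta> / 2 * (1 - \<gamma>)" by (simp add: c_def)
    then have "(2 * c + \<delta>) / (1 - \<gamma>) \<le> \<theta> / 2" using \<gamma>_less by (simp add: pos_divide_le_eq)
    then show ?thesis by (simp add: add_divide_distrib)
  qed
  from bound obtain g' where g': "summable_mean \<pi> \<nu> g'"
    "\<And>h. ?Vo h - ?Vx h \<le> (\<tau> + \<kappa> + 2 * c + \<delta>) / (1 - \<gamma>) + \<theta> / 2 + g' h" by blast
  have "?Vo h - ?Vx h \<le> (\<tau> + \<kappa>) / (1 - \<gamma>) + \<theta> + g' h" for h
    using g'(2)[of h] le by linarith
  then show ?thesis using g'(1) unfolding \<kappa>_def by blast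
qed

lemma AE_limsup_value_gap:
  assumes mix: "\<And>n. n < N \<Longrightarrow> mixture_predictor M N n (\<P> n) (\<omega> n) (\<psi> n)"
    and truth: "grain_of_truth \<gamma> rew H M N \<P> \<pi> \<nu>"
    and pol: "aiqi_policy \<gamma> rew H M N \<tau> \<psi> \<pi>" and \<tau>: "0 < \<tau>" "\<tau> \<le> 1"
    and w: "0 < w" and dom: "\<And>h. w * env_prob \<nu> h \<le> env_prob \<xi> h"
    and \<epsilon>: "(\<tau> + (1 / real M + \<gamma> ^ H)) / (1 - \<gamma>) < \<epsilon>"
  shows "AE h in interaction \<pi> \<nu>. limsup (\<lambda>t. ereal (opt_value \<gamma> rew \<xi> (hist_before h t)
    - policy_value \<gamma> rew \<pi> \<xi> (hist_before h t))) \<le> ereal \<epsilon>"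
proof -
  obtain g where g: "summable_mean \<pi> \<nu> g"
    and le: "\<And>h. opt_value \<gamma> rew \<xi> h - policy_value \<gamma> rew \<pi> \<xi> h \<le> \<epsilon> + g h"
    \<comment> \<open>The strict inequality in the hypothesis leaves a positive margin, which is
      spent as \<open>\<theta>\<close>.\<close>
    using value_gap_bound[OF mix truth pol \<tau> w dom, of "\<epsilon> - (\<tau> + (1 / real M + \<gamma> ^ H)) / (1 - \<gamma>)"] \<epsilon> by auto
  from summable_mean_AE_tendsto_0[OF g] show ?thesis
  proof eventually_elim
    case (elim \<omega>)
    have "(\<lambda>t. ereal (\<epsilon> + g (hist_before \<omega> t))) \<longlonglongrightarrow> ereal (\<epsilon> + 0)"
      by (intro tendsto_intros elim)
    then have "limsup (\<lambda>t. ereal (\<epsilon> + g (hist_before \<omega> t))) = ereal \<epsilon>"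
      by (simp add: lim_imp_Limsup)
    moreover have "limsup (\<lambda>t. ereal (opt_value \<gamma> rew \<xi> (hist_before \<omega> t) - policy_value \<gamma> rew \<pi> \<xi> (hist_before \<omega> t)))
        \<le> limsup (\<lambda>t. ereal (\<epsilon> + g (hist_before \<omega> t)))"
      using le by (intro Limsup_mono always_eventually) simp
    ultimately show ?case by simp
  qed
qed

end

section \<open>Transfer to the mixture measure\<close>

lemma hist_prob_eq_env_prob:
  "hist_prob \<pi> \<nu> h = (\<Prod>i<length h. pmf (\<pi> (take i h)) (fst (h ! i))) * env_prob \<nu> h"
proof -
  have "hist_prob \<pi> \<nu> h = (\<Prod>i<length h. pmf (\<pi> (take i h)) (fst (h ! i)) * pmf (\<nu> (take i h) (fst (h ! i))) (snd (h ! i)))"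
    unfolding hist_prob_def by (intro prod.cong refl) (simp add: pmf_step_pmf[symmetric])
  then show ?thesis by (simp add: env_prob_def prod.distrib)
qed

lemma expectation_pmf_has_sum:
  assumes "((\<lambda>x. pmf p x * f x) has_sum s) (set_pmf p)"
  shows "measure_pmf.expectation p f = s"
proof -
  have s: "((\<lambda>x. pmf p x * f x) has_sum s) UNIV"
    by (rule has_sum_cong_neutral[THEN iffD1, OF _ _ _ assms]) (auto simp: set_pmf_iff)
  then have "Infinite_Sum.abs_summable_on (\<lambda>x. pmf p x * f x) UNIV"
    by (rule summable_on_iff_abs_summable_on_real[THEN iffD1, OF has_sum_imp_summable])
  then have "infsetsum (\<lambda>x. pmf p x * f x) UNIV = s"
    unfolding abs_summable_equivalent using infsumI[OF s] by (simp add: infsetsum_infsum)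
  then show ?thesis by (simp add: pmf_expectation_eq_infsetsum)
qed

text \<open>Interacting with \<open>\<xi>\<close> amounts to drawing \<open>\<nu>\<close> from the
  prior and interacting with it: on cylinders the policy factor is common to all environments and
  comes out of the sum.\<close>

lemma interaction_mixture:
  fixes \<pi> :: "('a::finite, 'o::finite, 'r::finite) policy"
  assumes mix: "mixture_env \<M> w \<xi>"
  shows "interaction \<pi> \<xi> = measure_pmf w \<bind> interaction \<pi>"
proof (rule interaction_eqI)
  have K: "interaction \<pi> \<in> measurable (measure_pmf w) (subprob_algebra (PiM UNIV (\<lambda>_. count_space UNIV)))"
    by (rule subprob_measurable_pmf[OF sets_interaction prob_space_interaction])
  show "sets (measure_pmf w \<bind> interaction \<pi>) = sets (PiM UNIV (\<lambda>_. count_space UNIV))"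
    by (rule sets_bind) (auto simp: sets_interaction)
  fix h :: "('a, 'o, 'r) history"
  let ?c = "\<Prod>i<length h. pmf (\<pi> (take i h)) (fst (h ! i))"
  have s: "((\<lambda>\<nu>. pmf w \<nu> * hist_prob \<pi> \<nu> h) has_sum hist_prob \<pi> \<xi> h) (set_pmf w)"
    using mix has_sum_cmult_right[of "\<lambda>\<nu>. pmf w \<nu> * env_prob \<nu> h" "set_pmf w" "env_prob \<xi> h" ?c]
    by (auto simp: mixture_env_def hist_prob_eq_env_prob mult.left_commute)
  have bound: "norm (hist_prob \<pi> \<nu> h) \<le> 1" for \<nu> :: "('a, 'o, 'r) env"
  proof -
    interpret prob_space "interaction \<pi> \<nu>" by (rule prob_space_interaction)
    show ?thesis
      using emeasure_interaction_cylinder[of \<pi> \<nu> h] hist_prob_nonneg[of \<pi> \<nu> h]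
      by (metis abs_of_nonneg emeasure_eq_measure ennreal_inj measure_nonneg prob_le_1 real_norm_def)
  qed
  have "emeasure (measure_pmf w \<bind> interaction \<pi>) {\<omega>. map \<omega> [0..<length h] = h} =
      (\<integral>\<^sup>+\<nu>. ennreal (hist_prob \<pi> \<nu> h) \<partial>measure_pmf w)"
    by (subst emeasure_bind[OF _ K sets_cylinder]) (auto simp: emeasure_interaction_cylinder)
  also have "\<dots> = ennreal (measure_pmf.expectation w (\<lambda>\<nu>. hist_prob \<pi> \<nu> h))"
    using bound by (intro nn_integral_eq_integral measure_pmf.integrable_const_bound[of _ 1])
      (auto simp: hist_prob_nonneg)
  also have "\<dots> = ennreal (hist_prob \<pi> \<xi> h)"
    by (simp only: expectation_pmf_has_sum[OF s])
  finally show "emeasure (measure_pmf w \<bind> interaction \<pi>) {\<omega>. map \<omega> [0..<length h] = h} = ennreal (hist_prob \<pi> \<xi> h)" .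
qed

lemma mixture_env_dominates:
  assumes "mixture_env \<M> w \<xi>" "\<nu> \<in> \<M>"
  shows "pmf w \<nu> * env_prob \<nu> h \<le> env_prob \<xi> h"
proof -
  have all: "((\<lambda>\<nu>. pmf w \<nu> * env_prob \<nu> h) has_sum env_prob \<xi> h) \<M>"
    using assms by (simp add: mixture_env_def)
  have single: "((\<lambda>\<nu>. pmf w \<nu> * env_prob \<nu> h) has_sum (pmf w \<nu> * env_prob \<nu> h)) {\<nu>}"
    using has_sum_finite[of "{\<nu>}" "\<lambda>\<nu>. pmf w \<nu> * env_prob \<nu> h"] by simp
  show ?thesis
    using assms(2) by (intro has_sum_mono_neutral[OF single all]) (auto simp: env_prob_def prod_nonneg)
qed

lemma power_effective_horizon_le:
  assumes "0 < \<gamma>" "\<gamma> < 1" "0 < \<eta>"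
  shows "\<gamma> ^ effective_horizon \<gamma> \<eta> \<le> \<eta>"
proof -
  have tail: "(1 - \<gamma>) * (\<Sum>k. \<gamma> ^ (H + k)) = \<gamma> ^ H" for H
    using assms suminf_mult[OF summable_geometric[of \<gamma>], of "\<gamma> ^ H"] suminf_geometric[of \<gamma>]
    by (simp add: power_add)
  \<comment> \<open>\<open>Suc K\<close> will witness that the set under \<open>LEAST\<close> is
    nonempty; the successor ensures positivity.\<close>
  obtain K where "\<gamma> ^ K < \<eta>" using real_arch_pow_inv[OF assms(3,2)] by auto
  moreover have "\<gamma> ^ Suc K \<le> \<gamma> ^ K" using assms by (intro power_decreasing) auto
  ultimately have "\<gamma> ^ Suc K \<le> \<eta>" by simp
  let ?P = "\<lambda>H. 0 < H \<and> (1 - \<gamma>) * (\<Sum>k. \<gamma> ^ (H + k)) \<le> \<eta>"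
  have "?P (Suc K)" using \<open>\<gamma> ^ Suc K \<le> \<eta>\<close> unfolding tail by simp
  then have "?P (LEAST H. ?P H)" by (rule LeastI[of ?P])
  then show ?thesis unfolding tail effective_horizon_def by simp
qed

theorem theorem16:
  fixes rew :: "'r::finite \<Rightarrow> real" and \<gamma> \<epsilon> \<tau> \<eta> :: real and H M N :: nat
    and \<M> :: "('a::finite, 'o::finite, 'r) env set" and w :: "('a, 'o, 'r) env pmf"
    and \<xi> :: "('a, 'o, 'r) env" and \<pi> :: "('a, 'o, 'r) policy"
    and \<P> :: "nat \<Rightarrow> ('a, 'o, 'r) predictor set"
    and \<omega> :: "nat \<Rightarrow> ('a, 'o, 'r) predictor pmf"
    and \<psi> :: "nat \<Rightarrow> ('a, 'o, 'r) predictor"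
  assumes "reward_structure rew" and "0 < \<gamma>" and "\<gamma> < 1" and "0 < \<epsilon>"
    and "countable \<M>"
    and "aiqi_params H M N \<tau>"
    and "\<tau> \<le> \<epsilon> * (1 - \<gamma>) / 10"
    and "real M \<ge> 10 / (\<epsilon> * (1 - \<gamma>))"
    and "0 < \<eta>" and "\<eta> \<le> \<epsilon> * (1 - \<gamma>) / 10" and "H = effective_horizon \<gamma> \<eta>"
    and "real N \<ge> real H + log \<gamma> (\<epsilon> / 5)"
    and "\<And>n. n < N \<Longrightarrow> mixture_predictor M N n (\<P> n) (\<omega> n) (\<psi> n)"
    and "aiqi_policy \<gamma> rew H M N \<tau> \<psi> \<pi>"
    and "\<And>\<nu>. \<nu> \<in> \<M> \<Longrightarrow> grain_of_truth \<gamma> rew H M N \<P> \<pi> \<nu>"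
    and "mixture_env \<M> w \<xi>"
  shows "(AE h in interaction \<pi> \<xi>.
            limsup (\<lambda>t. ereal (opt_value \<gamma> rew \<xi> (hist_before h t)
                              - policy_value \<gamma> rew \<pi> \<xi> (hist_before h t))) \<le> ereal \<epsilon>)
       \<and> (\<forall>\<nu>\<in>\<M>. AE h in interaction \<pi> \<nu>.
            limsup (\<lambda>t. ereal (opt_value \<gamma> rew \<xi> (hist_before h t)
                              - policy_value \<gamma> rew \<pi> \<xi> (hist_before h t))) \<le> ereal \<epsilon>)"
proof -
  have params: "0 < H" "0 < M" "H \<le> N" "0 < \<tau>" "\<tau> \<le> 1"
    using assms(6) by (auto simp: aiqi_params_def)
  have pos: "0 < \<epsilon> * (1 - \<gamma>)" using assms by simp
  have "1 / real M \<le> \<epsilon> * (1 - \<gamma>) / 10"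
    using assms(8) pos params(2) by (simp add: field_simps)
  moreover have "\<gamma> ^ H \<le> \<epsilon> * (1 - \<gamma>) / 10"
    using power_effective_horizon_le[OF assms(2,3,9)] assms(10,11) by simp
  \<comment> \<open>Each of the three errors is at most a tenth of the right-hand side, so the
    inequality is strict.\<close>
  ultimately have "\<tau> + (1 / real M + \<gamma> ^ H) < \<epsilon> * (1 - \<gamma>)"
    using assms(7) pos by linarith
  then have \<epsilon>: "(\<tau> + (1 / real M + \<gamma> ^ H)) / (1 - \<gamma>) < \<epsilon>"
    using assms(3) by (simp add: pos_divide_less_eq)
  let ?ok = "\<lambda>h. limsup (\<lambda>t. ereal (opt_value \<gamma> rew \<xi> (hist_before h t)
    - policy_value \<gamma> rew \<pi> \<xi> (hist_before h t))) \<le> ereal \<epsilon>"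
  have AE: "AE h in interaction \<pi> \<nu>. ?ok h" if \<nu>: "\<nu> \<in> \<M>" for \<nu>
  proof -
    \<comment> \<open>The uniform part of the policy gives every action probability at least
      \<open>\<tau> / CARD('a)\<close>.\<close>
    interpret return_prediction \<gamma> "\<tau> / real CARD('a)" rew \<pi> \<nu> H M N
      by unfold_locales (use assms params in \<open>auto intro: aiqi_policy_exploring\<close>)
    show ?thesis
      using assms(13,14,15) params mixture_env_dominates[OF assms(16) \<nu>] \<epsilon> \<nu> assms(16)
      by (intro AE_limsup_value_gap[where w="pmf w \<nu>"]) (auto simp: mixture_env_def pmf_positive_iff)
  qed
  have meas: "(\<lambda>h. f (hist_before h t)) \<in> borel_measurable (PiM UNIV (\<lambda>_. count_space UNIV))"
    for f :: "('a, 'o, 'r) history \<Rightarrow> ereal" and t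
    unfolding hist_before_def by (rule measurable_compose[OF measurable_prefix]) simp
  have "(\<lambda>h. limsup (\<lambda>t. ereal (opt_value \<gamma> rew \<xi> (hist_before h t)
      - policy_value \<gamma> rew \<pi> \<xi> (hist_before h t)))) \<in> borel_measurable (PiM UNIV (\<lambda>_. count_space UNIV))"
    by (intro borel_measurable_limsup meas)
  then have pred: "Measurable.pred (PiM UNIV (\<lambda>_. count_space UNIV)) ?ok" by measurable
  \<comment> \<open>As \<open>?ok\<close> is measurable, it holds almost surely under the mixture
    once it does so for each environment in the support of \<open>w\<close>, which is
    \<open>\<M>\<close>.\<close>
  have "AE h in interaction \<pi> \<xi>. ?ok h"
    unfolding interaction_mixture[OF assms(16)]
    using AE assms(16)
    by (subst AE_bind[OF subprob_measurable_pmf[OF sets_interaction prob_space_interaction] pred])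
      (auto simp: AE_measure_pmf_iff mixture_env_def)
  then show ?thesis using AE by blast
qed

end
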